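(* Let $(M,\nabla,g)$ be a compact connected Hessian manifold, and let $d_g$ denote the Riemannian distance induced on $M$ by $g$. There exists $C_1>0$ such that for all $u\in\mathcal{K}_0(M,g)$ and all $x,x'\in M$, $$|u(x)-u(x')|\leq C_1\,d_g(x,x').$$
   Context: An affine manifold $(M,\nabla)$ is a manifold with a flat torsion-free connection $\nabla$; equivalently it has an atlas of affine charts whose transition maps are (locally) affine maps $x\mapsto Ax+b$ of $\mathbb{R}^n$. A Hessian metric on $(M,\nabla)$ is a Riemannian metric $g$ which is locally of the form $g=\nabla d\phi$ with $\phi$ a smooth (strictly convex) function, i.e. $g_{ij}=\partial^2\phi/\partial x^i\partial x^j$ in affine coordinates; $(M,\nabla,g)$ is then a Hessian manifold. A function $u:M\to\mathbb{R}$ is $g$-convex if it is continuous and, on every affine chart domain $U$ with convex image in $\mathbb{R}^n$ on which $g=\nabla d\phi$, the function $\phi+u$ is convex in the affine coordinates. $\mathcal{K}(M,g)$ is the set of all $g$-convex functions, and $\mathcal{K}_0(M,g)=\{u\in\mathcal{K}(M,g):\sup_M u=0\}$. *)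

theory Defs
  imports "HOL-Analysis.Analysis"
begin

section \<open>Smooth functions and coordinate Hessians\<close>

text \<open>Both notions are meant for open sets \<open>S\<close>: derivatives are taken in the whole space.\<close>

primrec Ck_on :: "nat \<Rightarrow> 'a::real_normed_vector set \<Rightarrow> ('a \<Rightarrow> 'b::real_normed_vector) \<Rightarrow> bool" where
  "Ck_on 0 S f \<longleftrightarrow> continuous_on S f"
| "Ck_on (Suc k) S f \<longleftrightarrow>
     (\<forall>x\<in>S. f differentiable at x) \<and> (\<forall>v. Ck_on k S (\<lambda>x. frechet_derivative f (at x) v))"

definition smooth_on :: "'a::real_normed_vector set \<Rightarrow> ('a \<Rightarrow> 'b::real_normed_vector) \<Rightarrow> bool" where
  "smooth_on S f \<longleftrightarrow> (\<forall>k. Ck_on k S f)"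

definition partial_deriv :: "'n::finite \<Rightarrow> (real ^ 'n \<Rightarrow> real) \<Rightarrow> real ^ 'n \<Rightarrow> real" where
  "partial_deriv i f y = frechet_derivative f (at y) (axis i 1)"

definition hessian :: "(real ^ 'n::finite \<Rightarrow> real) \<Rightarrow> real ^ 'n \<Rightarrow> real ^ 'n ^ 'n" where
  "hessian f y = (\<chi> i j. partial_deriv i (partial_deriv j f) y)"


section \<open>Affine manifolds\<close>

text \<open>A chart is a pair of its domain and its coordinate map; the values of the coordinate map
  outside the domain are irrelevant.\<close>

type_synonym ('a, 'n) chart = "'a set \<times> ('a \<Rightarrow> real ^ 'n)"

definition chart :: "'a topology \<Rightarrow> ('a, 'n::finite) chart \<Rightarrow> bool" where
  "chart X c \<longleftrightarrow> (case c of (U, f) \<Rightarrow>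
     openin X U \<and> open (f ` U) \<and>
     homeomorphic_map (subtopology X U) (top_of_set (f ` U)) f)"

text \<open>On \<open>W\<close> the transition from the coordinates \<open>f\<close> to the coordinates \<open>h\<close> is \<open>y \<mapsto> L y + b\<close>.\<close>

definition affine_transition ::
    "'a set \<Rightarrow> ('a \<Rightarrow> real ^ 'n) \<Rightarrow> ('a \<Rightarrow> real ^ 'n) \<Rightarrow> real ^ 'n ^ 'n \<Rightarrow> real ^ 'n \<Rightarrow> bool" where
  "affine_transition W f h L b \<longleftrightarrow> (\<forall>x\<in>W. h x = L *v f x + b)"

text \<open>As \<open>h\<close> is injective, \<open>L\<close> is automatically invertible here, so that compatibility is
  symmetric.\<close>

definition affinely_compatible ::
    "'a topology \<Rightarrow> ('a, 'n::finite) chart \<Rightarrow> ('a, 'n) chart \<Rightarrow> bool" where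
  "affinely_compatible X c d \<longleftrightarrow> (case (c, d) of ((U, f), (V, h)) \<Rightarrow>
     \<forall>x\<in>U \<inter> V. \<exists>W L b. openin X W \<and> x \<in> W \<and> W \<subseteq> U \<inter> V \<and> affine_transition W f h L b)"

text \<open>The flat torsion-free connection \<open>\<nabla>\<close> is encoded by an atlas of affine charts.\<close>

definition affine_manifold :: "'a topology \<Rightarrow> ('a, 'n::finite) chart set \<Rightarrow> bool" where
  "affine_manifold X A \<longleftrightarrow>
     Hausdorff_space X \<and> second_countable X \<and>
     (\<forall>c\<in>A. chart X c) \<and> (\<Union>c\<in>A. fst c) = topspace X \<and>
     (\<forall>c\<in>A. \<forall>d\<in>A. affinely_compatible X c d)"

text \<open>The maximal affine atlas, i.e. all affine charts of \<open>(M, \<nabla>)\<close>.\<close>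

definition affine_charts :: "'a topology \<Rightarrow> ('a, 'n::finite) chart set \<Rightarrow> ('a, 'n) chart set" where
  "affine_charts X A = {c. chart X c \<and>
     (\<forall>d\<in>A. affinely_compatible X c d \<and> affinely_compatible X d c)}"


section \<open>Hessian metrics\<close>

text \<open>A tensor field \<open>g\<close> of type (0,2) is given by its components in the affine charts:
  \<open>g (U, f) x $ i $ j\<close> is the component \<open>g\<^sub>i\<^sub>j\<close> at \<open>x\<close> in the coordinates \<open>f\<close>.\<close>

type_synonym ('a, 'n) tensor2 = "('a, 'n) chart \<Rightarrow> 'a \<Rightarrow> real ^ 'n ^ 'n"

definition covariant :: "'a topology \<Rightarrow> ('a, 'n::finite) chart set \<Rightarrow> ('a, 'n) tensor2 \<Rightarrow> bool" where
  "covariant X A g \<longleftrightarrow>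
     (\<forall>(U, f)\<in>affine_charts X A. \<forall>(V, h)\<in>affine_charts X A. \<forall>W L b.
        openin X W \<and> W \<subseteq> U \<inter> V \<and> affine_transition W f h L b \<longrightarrow>
        (\<forall>x\<in>W. g (U, f) x = transpose L ** g (V, h) x ** L))"

definition riemannian_metric ::
    "'a topology \<Rightarrow> ('a, 'n::finite) chart set \<Rightarrow> ('a, 'n) tensor2 \<Rightarrow> bool" where
  "riemannian_metric X A g \<longleftrightarrow> covariant X A g \<and>
     (\<forall>(U, f)\<in>affine_charts X A.
        smooth_on (f ` U) (g (U, f) \<circ> inv_into U f) \<and>
        (\<forall>x\<in>U. transpose (g (U, f) x) = g (U, f) x \<and>
               (\<forall>v. v \<noteq> 0 \<longrightarrow> v \<bullet> (g (U, f) x *v v) > 0)))"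

text \<open>\<open>\<phi>\<close> is smooth with \<open>g = \<nabla>d\<phi>\<close> on the domain of the affine chart \<open>c\<close>.\<close>

definition hessian_potential :: "('a, 'n::finite) tensor2 \<Rightarrow> ('a, 'n) chart \<Rightarrow> ('a \<Rightarrow> real) \<Rightarrow> bool" where
  "hessian_potential g c \<phi> \<longleftrightarrow> (case c of (U, f) \<Rightarrow>
     smooth_on (f ` U) (\<phi> \<circ> inv_into U f) \<and>
     (\<forall>x\<in>U. g (U, f) x = hessian (\<phi> \<circ> inv_into U f) (f x)))"

definition hessian_manifold ::
    "'a topology \<Rightarrow> ('a, 'n::finite) chart set \<Rightarrow> ('a, 'n) tensor2 \<Rightarrow> bool" where
  "hessian_manifold X A g \<longleftrightarrow> affine_manifold X A \<and> riemannian_metric X A g \<and>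
     (\<forall>x\<in>topspace X. \<exists>c\<in>affine_charts X A. x \<in> fst c \<and> (\<exists>\<phi>. hessian_potential g c \<phi>))"


section \<open>Riemannian distance\<close>

text \<open>Away from finitely many parameters the curve is \<open>C\<^sup>1\<close>, and at these it has one-sided
  derivatives: on every closed interval without break point in its interior, the coordinate
  expression is \<open>C\<^sup>1\<close> up to the end points.\<close>

definition piecewise_C1_curve ::
    "'a topology \<Rightarrow> ('a, 'n::finite) chart set \<Rightarrow> (real \<Rightarrow> 'a) \<Rightarrow> bool" where
  "piecewise_C1_curve X A \<gamma> \<longleftrightarrow> pathin X \<gamma> \<and>
     (\<exists>S. finite S \<and>
        (\<forall>a b. 0 \<le> a \<and> a < b \<and> b \<le> 1 \<and> {a<..<b} \<inter> S = {} \<longrightarrow>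
          (\<forall>(U, f)\<in>affine_charts X A. \<gamma> ` {a..b} \<subseteq> U \<longrightarrow>
             (\<exists>D. continuous_on {a..b} D \<and>
                (\<forall>t\<in>{a..b}. ((f \<circ> \<gamma>) has_vector_derivative D t) (at t within {a..b}))))))"

text \<open>The choice of the affine chart around \<open>\<gamma> t\<close> does not matter where \<open>\<gamma>\<close> is differentiable,
  by covariance of \<open>g\<close>. At the finitely many break points the value is irrelevant for the
  length.\<close>

definition speed ::
    "'a topology \<Rightarrow> ('a, 'n::finite) chart set \<Rightarrow> ('a, 'n) tensor2 \<Rightarrow> (real \<Rightarrow> 'a) \<Rightarrow> real \<Rightarrow> real" where
  "speed X A g \<gamma> t =
     (let c = (SOME c. c \<in> affine_charts X A \<and> \<gamma> t \<in> fst c);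
          v = vector_derivative (snd c \<circ> \<gamma>) (at t within {0..1})
      in sqrt (v \<bullet> (g c (\<gamma> t) *v v)))"

definition curve_length ::
    "'a topology \<Rightarrow> ('a, 'n::finite) chart set \<Rightarrow> ('a, 'n) tensor2 \<Rightarrow> (real \<Rightarrow> 'a) \<Rightarrow> real" where
  "curve_length X A g \<gamma> = integral {0..1} (speed X A g \<gamma>)"

text \<open>For points in different components of \<open>X\<close> the value is unspecified.\<close>

definition riem_dist ::
    "'a topology \<Rightarrow> ('a, 'n::finite) chart set \<Rightarrow> ('a, 'n) tensor2 \<Rightarrow> 'a \<Rightarrow> 'a \<Rightarrow> real" where
  "riem_dist X A g x x' =
     Inf {curve_length X A g \<gamma> |\<gamma>. piecewise_C1_curve X A \<gamma> \<and> \<gamma> 0 = x \<and> \<gamma> 1 = x'}"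


section \<open>\<open>g\<close>-convex functions\<close>

definition g_convex ::
    "'a topology \<Rightarrow> ('a, 'n::finite) chart set \<Rightarrow> ('a, 'n) tensor2 \<Rightarrow> ('a \<Rightarrow> real) set" where
  "g_convex X A g = {u. continuous_map X euclideanreal u \<and>
     (\<forall>(U, f)\<in>affine_charts X A. \<forall>\<phi>. convex (f ` U) \<and> hessian_potential g (U, f) \<phi> \<longrightarrow>
        convex_on (f ` U) ((\<lambda>x. \<phi> x + u x) \<circ> inv_into U f))}"

definition g_convex0 ::
    "'a topology \<Rightarrow> ('a, 'n::finite) chart set \<Rightarrow> ('a, 'n) tensor2 \<Rightarrow> ('a \<Rightarrow> real) set" where
  "g_convex0 X A g = {u \<in> g_convex X A g.
     bdd_above (u ` topspace X) \<and> (SUP x\<in>topspace X. u x) = 0}"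

end

theory Submission
  imports Defs
begin

text \<open>
  If \<open>\<phi> + u\<close> is convex near \<open>a\<close> in affine coordinates and \<open>u \<le> 0\<close>, then reflecting a nearby point
  \<open>b\<close> through \<open>a\<close> gives \<open>-u b \<le> 2 (-u a) + B\<close> with \<open>B\<close> depending on \<open>\<phi>\<close> only. Chaining these
  Harnack-type inequalities over the compact connected manifold, starting at a point where \<open>u\<close> is
  almost \<open>0\<close>, bounds all normalised \<open>u\<close> uniformly. Uniformly bounded convex functions are locally
  uniformly Lipschitz, and \<open>\<phi>\<close> is locally Lipschitz, so \<open>u\<close> is uniformly Lipschitz in each of
  finitely many charts; as \<open>g\<close> dominates a multiple of the Euclidean metric there, integrating
  along curves gives the claim. The curves joining two given points have to be shown to exist,
  since an infimum over the empty set would be unspecified.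
\<close>


section \<open>Affine charts\<close>

text \<open>The inverse supplied by the homeomorphism and \<open>inv_into U f\<close> need only
  agree on the chart image. That suffices, since continuity on a subspace sees only values
  there.\<close>

lemma chartD:
  fixes f :: "'a \<Rightarrow> real ^ 'n::finite"
  assumes "chart X (U, f)"
  shows "openin X U" "open (f ` U)" "inj_on f U"
    "continuous_map (subtopology X U) euclidean f"
    "continuous_map (top_of_set (f ` U)) X (inv_into U f)"
proof -
  have U: "openin X U" and o: "open (f ` U)"
    and hom: "homeomorphic_map (subtopology X U) (top_of_set (f ` U)) f"
    using assms by (auto simp: chart_def)
  have ts: "topspace (subtopology X U) = U"
    using openin_subset[OF U] by auto
  show "openin X U" "open (f ` U)" by fact+
  show inj: "inj_on f U"
    using hom ts unfolding homeomorphic_eq_everything_map by metis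
  show "continuous_map (subtopology X U) euclidean f"
    using hom unfolding homeomorphic_eq_everything_map
    by (metis continuous_map_into_fulltopology)
  obtain k where k: "homeomorphic_maps (subtopology X U) (top_of_set (f ` U)) f k"
    using hom homeomorphic_map_maps by blast
  have "continuous_map (top_of_set (f ` U)) (subtopology X U) k"
    using k by (simp add: homeomorphic_maps_def)
  moreover have "inv_into U f y = k y" if "y \<in> f ` U" for y
    using k inj ts that by (auto simp: homeomorphic_maps_def)
  ultimately have "continuous_map (top_of_set (f ` U)) (subtopology X U) (inv_into U f)"
    by (metis (no_types, lifting) continuous_map_eq topspace_euclidean_subtopology)
  then show "continuous_map (top_of_set (f ` U)) X (inv_into U f)"
    by (rule continuous_map_into_fulltopology)
qed

lemma openin_chart_preimage:
  fixes f :: "'a \<Rightarrow> real ^ 'n::finite"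
  assumes c: "chart X (U, f)" and B: "open B"
  shows "openin X {x \<in> U. f x \<in> B}"
proof -
  have U: "openin X U" using chartD[OF c] by simp
  have ts: "topspace (subtopology X U) = U"
    using openin_subset[OF U] by auto
  have "openin (subtopology X U) {x \<in> topspace (subtopology X U). f x \<in> B}"
    by (rule openin_continuous_map_preimage[OF chartD(4)[OF c]]) (use B in simp)
  then show ?thesis
    unfolding ts using U by (simp add: openin_open_subtopology)
qed

text \<open>A homeomorphism is an open map, so the image of \<open>V\<close> is open in the image of
  \<open>U\<close>, which is itself open in the coordinate space.\<close>

lemma chart_restrict:
  fixes f :: "'a \<Rightarrow> real ^ 'n::finite"
  assumes c: "chart X (U, f)" and V: "openin X V" "V \<subseteq> U"
  shows "chart X (V, f)"
proof -
  have U: "openin X U" and o: "open (f ` U)"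
    and hom: "homeomorphic_map (subtopology X U) (top_of_set (f ` U)) f"
    using c by (auto simp: chart_def)
  have ts: "topspace (subtopology X U) = U"
    using openin_subset[OF U] by auto
  have "openin (subtopology X U) V"
    using U V by (simp add: openin_open_subtopology)
  then have "openin (top_of_set (f ` U)) (f ` V)"
    using hom homeomorphic_imp_open_map open_map_def by blast
  then have oV: "open (f ` V)"
    using o openin_open_trans by blast
  have "homeomorphic_map (subtopology (subtopology X U) V) (subtopology (top_of_set (f ` U)) (f ` V)) f"
    by (rule homeomorphic_map_subtopologies[OF hom]) (use V ts in auto)
  moreover have "subtopology (subtopology X U) V = subtopology X V"
    using V by (simp add: subtopology_subtopology inf.absorb2)
  moreover have "subtopology (top_of_set (f ` U)) (f ` V) = top_of_set (f ` V)"
    using V by (simp add: subtopology_subtopology inf.absorb2 image_mono)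
  ultimately show ?thesis
    using V oV by (simp add: chart_def)
qed

lemma affinely_compatibleE:
  fixes f h :: "'a \<Rightarrow> real ^ 'n::finite"
  assumes "affinely_compatible X (U, f) (V, h)" "x \<in> U" "x \<in> V"
  obtains W L b where "openin X W" "x \<in> W" "W \<subseteq> U \<inter> V" "affine_transition W f h L b"
proof -
  have "\<exists>W L b. openin X W \<and> x \<in> W \<and> W \<subseteq> U \<inter> V \<and> affine_transition W f h L b"
    using assms unfolding affinely_compatible_def prod.case by blast
  then show thesis using that by blast
qed

text \<open>Compatibility is a local condition: intersecting each witness \<open>W\<close> with
  \<open>V\<close> keeps the same affine formula.\<close>

lemma affine_charts_restrict:
  fixes f :: "'a \<Rightarrow> real ^ 'n::finite"
  assumes c: "(U, f) \<in> affine_charts X A" and V: "openin X V" "V \<subseteq> U"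
  shows "(V, f) \<in> affine_charts X A"
proof -
  have "affinely_compatible X (V, f) d" if cd: "affinely_compatible X (U, f) d" for d
    unfolding affinely_compatible_def
  proof (clarsimp split: prod.split)
    fix V' h x assume d: "d = (V', h)" and x: "x \<in> V" "x \<in> V'"
    obtain W L b where W: "openin X W" "x \<in> W" "W \<subseteq> U \<inter> V'" "affine_transition W f h L b"
      by (rule affinely_compatibleE[OF cd[unfolded d] subsetD[OF V(2) x(1)] x(2)])
    show "\<exists>W. openin X W \<and> x \<in> W \<and> W \<subseteq> V \<and> W \<subseteq> V' \<and> (\<exists>L b. affine_transition W f h L b)"
    proof (intro exI[of _ "W \<inter> V"] conjI exI)
      show "affine_transition (W \<inter> V) f h L b" using W by (auto simp: affine_transition_def)
    qed (use W V x in auto)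
  qed
  moreover have "affinely_compatible X d (V, f)" if cd: "affinely_compatible X d (U, f)" for d
    unfolding affinely_compatible_def
  proof (clarsimp split: prod.split)
    fix V' h x assume d: "d = (V', h)" and x: "x \<in> V'" "x \<in> V"
    obtain W L b where W: "openin X W" "x \<in> W" "W \<subseteq> V' \<inter> U" "affine_transition W h f L b"
      by (rule affinely_compatibleE[OF cd[unfolded d] x(1) subsetD[OF V(2) x(2)]])
    show "\<exists>W. openin X W \<and> x \<in> W \<and> W \<subseteq> V' \<and> W \<subseteq> V \<and> (\<exists>L b. affine_transition W h f L b)"
    proof (intro exI[of _ "W \<inter> V"] conjI exI)
      show "affine_transition (W \<inter> V) h f L b" using W by (auto simp: affine_transition_def)
    qed (use W V x in auto)
  qed
  ultimately show ?thesis
    using c chart_restrict[OF _ V] by (auto simp: affine_charts_def)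
qed

text \<open>Membership in the maximal atlas only compares a chart with those of \<open>A\<close>. So
  the transition passes through a chart of \<open>A\<close> around \<open>x\<close>, and the
  composite of two affine maps is affine.\<close>

lemma affine_charts_transition:
  fixes f h :: "'a \<Rightarrow> real ^ 'n::finite"
  assumes M: "affine_manifold X A"
    and c: "(U, f) \<in> affine_charts X A" and d: "(V, h) \<in> affine_charts X A"
    and x: "x \<in> U" "x \<in> V"
  obtains W L b where "openin X W" "x \<in> W" "W \<subseteq> U \<inter> V" "affine_transition W f h L b"
proof -
  have "x \<in> topspace X"
    using c x openin_subset chartD(1) unfolding affine_charts_def by blast
  then obtain V' k where e: "(V', k) \<in> A" "x \<in> V'"
    using M unfolding affine_manifold_def by (metis UN_E prod.collapse)
  have ac: "affinely_compatible X (U, f) (V', k)" "affinely_compatible X (V', k) (V, h)"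
    using c d e by (auto simp: affine_charts_def)
  obtain W1 L1 b1 where
    W1: "openin X W1" "x \<in> W1" "W1 \<subseteq> U \<inter> V'" "affine_transition W1 f k L1 b1"
    by (rule affinely_compatibleE[OF ac(1) x(1) e(2)])
  obtain W2 L2 b2 where
    W2: "openin X W2" "x \<in> W2" "W2 \<subseteq> V' \<inter> V" "affine_transition W2 k h L2 b2"
    by (rule affinely_compatibleE[OF ac(2) e(2) x(2)])
  show thesis
  proof (rule that)
    show "affine_transition (W1 \<inter> W2) f h (L2 ** L1) (L2 *v b1 + b2)"
      using W1(4) W2(4)
      by (auto simp: affine_transition_def matrix_vector_right_distrib simp flip: matrix_vector_mul_assoc)
  qed (use W1 W2 in auto)
qed

lemma affine_charts_chart: "c \<in> affine_charts X A \<Longrightarrow> chart X c"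
  by (auto simp: affine_charts_def)

lemma covariantD:
  assumes "covariant X A g" "(U, f) \<in> affine_charts X A" "(V, h) \<in> affine_charts X A"
    "openin X W" "W \<subseteq> U \<inter> V" "affine_transition W f h L b" "x \<in> W"
  shows "g (U, f) x = transpose L ** g (V, h) x ** L"
  using assms(1)[unfolded covariant_def, rule_format, OF assms(2), unfolded prod.case,
      rule_format, OF assms(3), unfolded prod.case, rule_format] assms(4-) by blast

section \<open>Locality of smoothness and of the Hessian\<close>

text \<open>\<open>frechet_derivative\<close> is a choice from the maps satisfying the derivative
  relation. Functions agreeing near \<open>x\<close> have the same relation, hence the same chosen
  value, even where no derivative exists.\<close>

lemma frechet_derivative_cong_open:
  assumes "open S" "x \<in> S" "\<And>y. y \<in> S \<Longrightarrow> f y = h y"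
  shows "frechet_derivative f (at x) = frechet_derivative h (at x)"
proof -
  have "(f has_derivative D) (at x) \<longleftrightarrow> (h has_derivative D) (at x)" for D
    using assms by (metis has_derivative_transform_within_open)
  then show ?thesis by (simp add: frechet_derivative_def)
qed

text \<open>The induction varies both functions, because its step applies the hypothesis to their
  derivatives in a fixed direction, which again agree on \<open>S\<close>.\<close>

lemma Ck_on_cong_open:
  assumes "open S" "Ck_on k T f" "S \<subseteq> T" "\<And>y. y \<in> S \<Longrightarrow> f y = h y"
  shows "Ck_on k S h"
  using assms(2,4)
proof (induction k arbitrary: f h)
  case 0
  then show ?case
    using assms(3) by (metis Ck_on.simps(1) continuous_on_cong continuous_on_subset)
next
  case (Suc k)
  have "h differentiable at x" if "x \<in> S" for x
    using Suc.prems that assms(1,3) unfolding differentiable_def Ck_on.simps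
    by (metis has_derivative_transform_within_open subsetD)
  moreover have "Ck_on k S (\<lambda>x. frechet_derivative h (at x) v)" for v
    using Suc.prems frechet_derivative_cong_open[OF assms(1), of _ f h]
    by (intro Suc.IH[of "\<lambda>x. frechet_derivative f (at x) v"]) auto
  ultimately show ?case by simp
qed

text \<open>First partial derivatives agree on all of the open set, not just at \<open>x\<close>, so
  they can be differentiated once more.\<close>

lemma hessian_cong_open:
  assumes S: "open S" "x \<in> S" "\<And>y. y \<in> S \<Longrightarrow> f y = h y"
  shows "hessian f x = hessian h x"
proof -
  have "partial_deriv j f y = partial_deriv j h y" if "y \<in> S" for j y
    using frechet_derivative_cong_open[OF S(1) that S(3)] by (simp add: partial_deriv_def)
  then have "partial_deriv i (partial_deriv j f) x = partial_deriv i (partial_deriv j h) x" for i j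
    using frechet_derivative_cong_open[OF S(1,2), of "partial_deriv j f" "partial_deriv j h"]
    by (simp add: partial_deriv_def[of i])
  then show ?thesis by (simp add: hessian_def)
qed

section \<open>Potentials on smaller charts, down to coordinate balls\<close>

lemma hessian_potential_restrict:
  fixes f :: "'a \<Rightarrow> real ^ 'n::finite"
  assumes g: "covariant X A g" and c: "(U, f) \<in> affine_charts X A"
    and V: "openin X V" "V \<subseteq> U" and pot: "hessian_potential g (U, f) \<phi>"
  shows "hessian_potential g (V, f) \<phi>"
proof -
  have cV: "(V, f) \<in> affine_charts X A" by (rule affine_charts_restrict[OF c V])
  have oV: "open (f ` V)" using chartD(2)[OF affine_charts_chart[OF cV]] .
  have inj: "inj_on f U" "inj_on f V"
    using chartD(3) affine_charts_chart c cV by blast+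
  \<comment> \<open>The components of \<open>g\<close> in \<open>(V, f)\<close> and
    \<open>(U, f)\<close> are a priori unrelated values. Covariance along the identity transition
    identifies them on \<open>V\<close>.\<close>
  have "affine_transition V f f (mat 1) 0" by (simp add: affine_transition_def)
  then have gV: "g (V, f) x = g (U, f) x" if "x \<in> V" for x
    using covariantD[OF g cV c V(1) _ \<open>affine_transition V f f (mat 1) 0\<close> that] V(2)
    by (simp add: transpose_mat)
  have eq: "(\<phi> \<circ> inv_into U f) y = (\<phi> \<circ> inv_into V f) y" if "y \<in> f ` V" for y
    using that V inj by auto
  have "smooth_on (f ` V) (\<phi> \<circ> inv_into V f)"
    using pot Ck_on_cong_open[OF oV _ image_mono[OF V(2)], of _ "\<phi> \<circ> inv_into U f"] eq
    unfolding hessian_potential_def smooth_on_def prod.case by blast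
  moreover have "g (V, f) x = hessian (\<phi> \<circ> inv_into V f) (f x)" if "x \<in> V" for x
    using pot that V gV hessian_cong_open[OF oV _ eq, of "f x" "\<lambda>y. y"]
    by (auto simp: hessian_potential_def o_def)
  ultimately show ?thesis by (simp add: hessian_potential_def)
qed

text \<open>Shrinking a chart with a potential to the preimage of a ball makes its image convex. The
  definition of \<open>g\<close>-convexity then applies to it, and coordinate segments stay inside
  it.\<close>

lemma hessian_manifold_ball_chart:
  fixes A :: "('a, 'n::finite) chart set"
  assumes M: "hessian_manifold X A g" and p: "p \<in> topspace X"
  obtains U f \<phi> R where "(U, f) \<in> affine_charts X A" "p \<in> U" "R > 0" "f ` U = ball (f p) R"
    "hessian_potential g (U, f) \<phi>"
proof -
  obtain U f \<phi> where c: "(U, f) \<in> affine_charts X A" and pU: "p \<in> U"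
    and pot: "hessian_potential g (U, f) \<phi>"
    using M p unfolding hessian_manifold_def by fastforce
  have ch: "chart X (U, f)" using c by (rule affine_charts_chart)
  then obtain R where R: "R > 0" "ball (f p) R \<subseteq> f ` U"
    using chartD(2)[OF ch] pU by (meson imageI open_contains_ball)
  define V where "V = {x \<in> U. f x \<in> ball (f p) R}"
  have V: "openin X V" "V \<subseteq> U"
    unfolding V_def using openin_chart_preimage[OF ch open_ball] by auto
  have cov: "covariant X A g"
    using M by (simp add: hessian_manifold_def riemannian_metric_def)
  show thesis
  proof (rule that)
    show "(V, f) \<in> affine_charts X A" by (rule affine_charts_restrict[OF c V])
    show "p \<in> V" using pU R by (simp add: V_def)
    show "f ` V = ball (f p) R" using R(2) by (auto simp: V_def)
    show "hessian_potential g (V, f) \<phi>" by (rule hessian_potential_restrict[OF cov c V pot])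
  qed fact
qed


section \<open>Bounded convex functions and positive definite matrices\<close>

text \<open>\<open>a\<close> is the midpoint of \<open>b\<close> and its reflection
  \<open>2 *\<^sub>R a - b\<close>.\<close>

lemma convex_on_reflect:
  fixes F :: "'a::real_vector \<Rightarrow> real"
  assumes "convex_on S F" "b \<in> S" "2 *\<^sub>R a - b \<in> S"
  shows "2 * F a \<le> F b + F (2 *\<^sub>R a - b)"
proof -
  have "a = (1/2) *\<^sub>R b + (1/2) *\<^sub>R (2 *\<^sub>R a - b)"
    by (simp add: scaleR_right_diff_distrib)
  then have "F a \<le> (1/2) * F b + (1/2) * F (2 *\<^sub>R a - b)"
    using convex_onD[OF assms(1), of "1/2" b "2 *\<^sub>R a - b"] assms(2,3) by simp
  then show ?thesis by simp
qed

text \<open>Prolonging the segment from \<open>a\<close> to \<open>b\<close> by length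
  \<open>r\<close> stays in the larger ball. Convexity bounds the increment up to \<open>b\<close>
  by a fraction of the increment up to the far end, which is at most \<open>2 * B\<close>.\<close>

lemma convex_on_bounded_lipschitz:
  fixes F :: "'a::real_normed_vector \<Rightarrow> real"
  assumes cv: "convex_on (ball q (3 * r)) F" and r: "r > 0"
    and bd: "\<And>y. y \<in> ball q (3 * r) \<Longrightarrow> \<bar>F y\<bar> \<le> B"
    and a: "a \<in> ball q r" and b: "b \<in> ball q r"
  shows "\<bar>F a - F b\<bar> \<le> 2 * B / r * norm (a - b)"
proof -
  have one_sided: "F b - F a \<le> 2 * B / r * norm (a - b)"
    if a: "a \<in> ball q r" and b: "b \<in> ball q r" for a b
  proof (cases "a = b")
    case False
    define d where "d = norm (b - a)"
    \<comment> \<open>\<open>z\<close> lies at distance \<open>r\<close> beyond \<open>b\<close> on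
      the ray from \<open>a\<close>, and \<open>t\<close> is the weight for which \<open>b\<close>
      equals \<open>(1 - t) *\<^sub>R a + t *\<^sub>R z\<close>.\<close>
    define z where "z = b + (r / d) *\<^sub>R (b - a)"
    define t where "t = d / (d + r)"
    have d: "d > 0" using False by (simp add: d_def)
    have t: "0 \<le> t" "t \<le> 1" "t \<le> d / r" using d r by (auto simp: t_def field_simps)
    have "norm (z - b) = r" using d r by (simp add: z_def d_def)
    then have "dist q z < 3 * r"
      using b r dist_triangle[of q z b] by (simp add: dist_norm norm_minus_commute)
    then have z: "z \<in> ball q (3 * r)" by simp
    have a': "a \<in> ball q (3 * r)" using a r by simp
    have tr: "t * (r / d) = 1 - t" using d r by (simp add: t_def divide_simps)
    have "t *\<^sub>R z = t *\<^sub>R b + (t * (r / d)) *\<^sub>R (b - a)"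
      by (simp add: z_def scaleR_right_distrib)
    then have "b = (1 - t) *\<^sub>R a + t *\<^sub>R z"
      unfolding tr by (simp add: algebra_simps)
    then have "F b \<le> (1 - t) * F a + t * F z"
      using convex_onD[OF cv t(1,2) a' z] by simp
    then have "F b - F a \<le> t * (F z - F a)" by (simp add: algebra_simps)
    also have "\<dots> \<le> t * (2 * B)"
      using t bd[OF z] bd[OF a'] by (intro mult_left_mono) auto
    also have "\<dots> \<le> d / r * (2 * B)"
      using t bd[OF z] by (intro mult_right_mono) auto
    finally show ?thesis by (simp add: d_def norm_minus_commute field_simps)
  qed simp
  show ?thesis
    using one_sided[OF a b] one_sided[OF b a] by (simp add: abs_le_iff norm_minus_commute)
qed

text \<open>Continuity of the derivative is known only direction by direction. Bounds on the
  finitely many basis directions control the operator norm, and the mean value inequality on the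
  convex set \<open>K\<close> finishes.\<close>

lemma Ck_on_lipschitz:
  fixes f :: "'a::euclidean_space \<Rightarrow> real"
  assumes f: "Ck_on (Suc 0) S f" and K: "convex K" "compact K" "K \<subseteq> S"
  obtains L where "L \<ge> 0" "\<And>x y. x \<in> K \<Longrightarrow> y \<in> K \<Longrightarrow> \<bar>f x - f y\<bar> \<le> L * norm (x - y)"
proof -
  have "\<exists>B. \<forall>x\<in>K. \<bar>frechet_derivative f (at x) v\<bar> \<le> B" for v
  proof -
    have "continuous_on K (\<lambda>x. frechet_derivative f (at x) v)"
      using f K(3) by (auto intro: continuous_on_subset)
    then have "bounded ((\<lambda>x. frechet_derivative f (at x) v) ` K)"
      using K(2) compact_continuous_image compact_imp_bounded by blast
    then show ?thesis by (auto simp: bounded_iff)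
  qed
  then obtain B where B: "\<And>v x. x \<in> K \<Longrightarrow> \<bar>frechet_derivative f (at x) v\<bar> \<le> B v"
    by metis
  define L where "L = (\<Sum>i\<in>Basis. \<bar>B i\<bar>)"
  have d: "(f has_derivative frechet_derivative f (at x)) (at x)" if "x \<in> K" for x
    using f K(3) that frechet_derivative_works by fastforce
  have "onorm (frechet_derivative f (at x)) \<le> L" if "x \<in> K" for x
  proof -
    have "onorm (frechet_derivative f (at x)) \<le> (\<Sum>i\<in>Basis. norm (frechet_derivative f (at x) i))"
      by (rule onorm_componentwise) (use d[OF that] in \<open>rule has_derivative_bounded_linear\<close>)
    also have "\<dots> \<le> L"
      unfolding L_def using B[OF that] by (intro sum_mono) (smt (verit) real_norm_def)
    finally show ?thesis .
  qed
  then have "norm (f x - f y) \<le> L * norm (x - y)" if "x \<in> K" "y \<in> K" for x y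
    using differentiable_bound[OF K(1) has_derivative_at_withinI[OF d] _ that] by blast
  moreover have "L \<ge> 0" by (simp add: L_def sum_nonneg)
  ultimately show thesis using that by (simp add: real_norm_def)
qed

section \<open>Continuous families of quadratic forms\<close>

lemma continuous_on_matrix_form:
  fixes G :: "'a::topological_space \<Rightarrow> real ^ 'n::finite ^ 'n"
  assumes "continuous_on S G" "continuous_on S v"
  shows "continuous_on S (\<lambda>x. v x \<bullet> (G x *v v x))"
  unfolding matrix_vector_mult_def inner_vec_def
  by (simp, intro continuous_intros assms)

text \<open>The quadratic form attains a positive minimum \<open>m\<close> over \<open>K\<close>
  times the unit sphere. By homogeneity \<open>1 / sqrt m\<close> then serves as \<open>l\<close>
  for all vectors.\<close>

lemma posdef_uniform:
  fixes G :: "'a::metric_space \<Rightarrow> real ^ 'n::finite ^ 'n"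
  assumes G: "continuous_on K G" and K: "compact K"
    and pos: "\<And>y v. y \<in> K \<Longrightarrow> v \<noteq> 0 \<Longrightarrow> v \<bullet> (G y *v v) > 0"
  obtains l where "l > 0" "\<And>y v. y \<in> K \<Longrightarrow> norm v \<le> l * sqrt (v \<bullet> (G y *v v))"
proof (cases "K = {}")
  case True
  then show thesis using that[of 1] by simp
next
  case False
  let ?S = "K \<times> sphere (0 :: real ^ 'n) 1"
  let ?q = "\<lambda>z. snd z \<bullet> (G (fst z) *v snd z)"
  have "continuous_on ?S ?q"
    by (intro continuous_on_matrix_form continuous_on_snd continuous_on_id
        continuous_on_compose2[OF G continuous_on_fst]) auto
  moreover have "compact ?S" using K by (simp add: compact_Times)
  moreover have "?S \<noteq> {}" using False by simp
  ultimately obtain z where z: "z \<in> ?S" "\<forall>w\<in>?S. ?q z \<le> ?q w"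
    using continuous_attains_inf[of ?S ?q] by blast
  define m where "m = ?q z"
  have m: "m > 0" unfolding m_def using z(1) by (intro pos) auto
  have bound: "norm v \<le> 1 / sqrt m * sqrt (v \<bullet> (G y *v v))" if y: "y \<in> K" for y v
  proof (cases "v = 0")
    case False
    have "m \<le> ?q (y, v /\<^sub>R norm v)"
      unfolding m_def using y False by (intro bspec[OF z(2)]) auto
    also have "\<dots> = (v \<bullet> (G y *v v)) / (norm v)\<^sup>2"
      by (simp add: matrix_vector_mult_scaleR power2_eq_square divide_inverse)
    finally have "m * (norm v)\<^sup>2 \<le> v \<bullet> (G y *v v)"
      using False by (simp add: field_simps)
    then have "sqrt m * norm v \<le> sqrt (v \<bullet> (G y *v v))"
      using real_sqrt_le_mono by (fastforce simp: real_sqrt_mult)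
    then show ?thesis using m by (simp add: field_simps)
  qed simp
  show thesis using that[of "1 / sqrt m"] m bound by simp
qed

section \<open>Local estimates for \<open>g\<close>-convex functions\<close>

text \<open>All constants come from the potential and the metric on balls in one chart, before any
  \<open>u\<close> is chosen. The three estimates compare the Euclidean norm with \<open>g\<close>,
  compare values of a nonpositive \<open>u\<close> at two points, and give a Lipschitz bound for a
  bounded \<open>u\<close>.\<close>

lemma g_convex_local_estimates:
  fixes A :: "('a, 'n::finite) chart set"
  assumes M: "hessian_manifold X A g" and p: "p \<in> topspace X"
  obtains U f W B c l where
    "(U, f) \<in> affine_charts X A" "openin X W" "p \<in> W" "W \<subseteq> U" "B \<ge> 0" "c \<ge> 0" "l > 0"
    "\<And>x v. x \<in> W \<Longrightarrow> norm v \<le> l * sqrt (v \<bullet> (g (U, f) x *v v))"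
    "\<And>u x y. \<lbrakk>u \<in> g_convex X A g; \<And>z. z \<in> topspace X \<Longrightarrow> u z \<le> 0; x \<in> W; y \<in> W\<rbrakk>
      \<Longrightarrow> - u y \<le> 2 * (- u x) + B"
    "\<And>u N x y. \<lbrakk>u \<in> g_convex X A g; \<And>z. z \<in> topspace X \<Longrightarrow> \<bar>u z\<bar> \<le> N; x \<in> W; y \<in> W\<rbrakk>
      \<Longrightarrow> \<bar>u x - u y\<bar> \<le> c * (B + N) * norm (f x - f y)"
proof -
  obtain U f \<phi> R where cU: "(U, f) \<in> affine_charts X A" and pU: "p \<in> U" and R: "R > 0"
    and im: "f ` U = ball (f p) R" and pot: "hessian_potential g (U, f) \<phi>"
    by (rule hessian_manifold_ball_chart[OF M p])
  have ch: "chart X (U, f)" using cU by (rule affine_charts_chart)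
  have inj: "inj_on f U" using chartD(3)[OF ch] .
  have Utop: "U \<subseteq> topspace X" using openin_subset[OF chartD(1)[OF ch]] .
  let ?k = "inv_into U f"
  let ?q = "f p"
  \<comment> \<open>For two points within \<open>r\<close> of the centre, reflecting one through the
    other lands within \<open>3 * r\<close>. The closed ball of that radius is compact inside the
    chart image, so the potential is bounded on it.\<close>
  define r where "r = R / 4"
  have r: "r > 0" using R by (simp add: r_def)
  have sub: "ball ?q (3 * r) \<subseteq> ball ?q R" "cball ?q (3 * r) \<subseteq> ball ?q R" "cball ?q r \<subseteq> ball ?q R"
    using R by (auto simp: r_def)
  have kU: "?k y \<in> U" "f (?k y) = y" if "y \<in> ball ?q R" for y
    using that im inv_into_into[of y f U] f_inv_into_f[of y f U] by auto
  define \<psi> where "\<psi> = \<phi> \<circ> ?k"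
  have sm: "smooth_on (ball ?q R) \<psi>"
    using pot by (simp add: hessian_potential_def \<psi>_def im)
  then have Ck: "Ck_on 0 (ball ?q R) \<psi>" "Ck_on (Suc 0) (ball ?q R) \<psi>"
    unfolding smooth_on_def by blast+
  then have "continuous_on (cball ?q (3 * r)) \<psi>"
    using sub by (auto intro: continuous_on_subset)
  then have "bounded (\<psi> ` cball ?q (3 * r))"
    using compact_cball compact_continuous_image compact_imp_bounded by blast
  then obtain P where P: "\<And>y. y \<in> cball ?q (3 * r) \<Longrightarrow> \<bar>\<psi> y\<bar> \<le> P"
    unfolding bounded_iff by (metis imageI real_norm_def)
  have P0: "P \<ge> 0" using P[of ?q] r by simp
  obtain L where L: "L \<ge> 0" "\<And>x y. x \<in> cball ?q r \<Longrightarrow> y \<in> cball ?q r \<Longrightarrow> \<bar>\<psi> x - \<psi> y\<bar> \<le> L * norm (x - y)"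
    using Ck_on_lipschitz[OF Ck(2) convex_cball compact_cball sub(3)] by metis
  have rm: "smooth_on (f ` U) (g (U, f) \<circ> ?k)"
    "\<And>x v. x \<in> U \<Longrightarrow> v \<noteq> 0 \<Longrightarrow> v \<bullet> (g (U, f) x *v v) > 0"
    using M cU unfolding hessian_manifold_def riemannian_metric_def by blast+
  have "Ck_on 0 (ball ?q R) (g (U, f) \<circ> ?k)"
    using rm(1) unfolding smooth_on_def im by blast
  then have "continuous_on (cball ?q r) (g (U, f) \<circ> ?k)"
    using sub(3) by (auto intro: continuous_on_subset)
  moreover have "v \<bullet> ((g (U, f) \<circ> ?k) y *v v) > 0" if "y \<in> cball ?q r" "v \<noteq> 0" for y v
    using rm(2)[OF kU(1), of y v] that sub(3) by auto
  ultimately obtain l where l: "l > 0"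
    "\<And>y v. y \<in> cball ?q r \<Longrightarrow> norm v \<le> l * sqrt (v \<bullet> ((g (U, f) \<circ> ?k) y *v v))"
    using posdef_uniform[OF _ compact_cball] by metis
  have cvx: "convex_on (ball ?q (3 * r)) (\<lambda>y. \<psi> y + u (?k y))" if "u \<in> g_convex X A g" for u
  proof -
    have "convex_on (f ` U) ((\<lambda>x. \<phi> x + u x) \<circ> ?k)"
      using that cU pot convex_ball[of ?q R] unfolding g_convex_def im[symmetric] by blast
    then show ?thesis
      unfolding im using sub(1) by (auto simp: \<psi>_def o_def intro: convex_on_subset)
  qed
  define W where "W = {x \<in> U. f x \<in> ball ?q r}"
  \<comment> \<open>Adding 1 to \<open>4 * P\<close> keeps the denominator positive, so that \<open>c * (4 * P + 1) \<ge> L\<close>.\<close>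
  define c where "c = 2 / r + L / (4 * P + 1)"
  show thesis
  proof (rule that)
    show "(U, f) \<in> affine_charts X A" by fact
    show "openin X W" unfolding W_def by (rule openin_chart_preimage[OF ch open_ball])
    show "p \<in> W" using pU r by (simp add: W_def)
    show "W \<subseteq> U" by (auto simp: W_def)
    show "4 * P + 1 \<ge> 0" using P0 by simp
    show "c \<ge> 0" using L(1) r P0 by (simp add: c_def)
    show "l > 0" by fact
    show "norm v \<le> l * sqrt (v \<bullet> (g (U, f) x *v v))" if "x \<in> W" for x v
      using l(2)[of "f x" v] that inj by (auto simp: W_def)
    show "- u y \<le> 2 * (- u x) + (4 * P + 1)"
      if u: "u \<in> g_convex X A g" "\<And>z. z \<in> topspace X \<Longrightarrow> u z \<le> 0" and x: "x \<in> W" and y: "y \<in> W"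
      for u x y
    proof -
      let ?z = "2 *\<^sub>R f x - f y"
      have eq: "?q - ?z = 2 *\<^sub>R (?q - f x) - (?q - f y)" by (simp add: algebra_simps scaleR_2)
      have "norm (?q - ?z) \<le> 2 * norm (?q - f x) + norm (?q - f y)"
        unfolding eq by (rule norm_triangle_le_diff) simp
      then have z: "?z \<in> ball ?q (3 * r)"
        using x y by (auto simp: W_def dist_norm)
      have xy: "f x \<in> ball ?q (3 * r)" "f y \<in> ball ?q (3 * r)" using x y r by (auto simp: W_def)
      have k: "?k (f x) = x" "?k (f y) = y" using x y inj by (auto simp: W_def)
      have "?k ?z \<in> topspace X" using kU(1)[of ?z] z sub(1) Utop by blast
      then have "u (?k ?z) \<le> 0" by (rule u(2))
      moreover have "2 * (\<psi> (f x) + u x) \<le> (\<psi> (f y) + u y) + (\<psi> ?z + u (?k ?z))"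
        using convex_on_reflect[OF cvx[OF u(1)] xy(2) z] k by simp
      ultimately show ?thesis
        using P[of "f x"] P[of "f y"] P[of ?z] z xy by (auto simp: abs_le_iff)
    qed
    show "\<bar>u x - u y\<bar> \<le> c * ((4 * P + 1) + N) * norm (f x - f y)"
      if u: "u \<in> g_convex X A g" "\<And>z. z \<in> topspace X \<Longrightarrow> \<bar>u z\<bar> \<le> N" and x: "x \<in> W" and y: "y \<in> W"
      for u N x y
    proof -
      let ?F = "\<lambda>y. \<psi> y + u (?k y)"
      have N0: "N \<ge> 0" using u(2)[OF p] by simp
      have xy: "f x \<in> ball ?q r" "f y \<in> ball ?q r" using x y by (auto simp: W_def)
      have k: "?k (f x) = x" "?k (f y) = y" using x y inj by (auto simp: W_def)
      have "\<bar>?F w\<bar> \<le> P + N" if "w \<in> ball ?q (3 * r)" for w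
      proof -
        have "?k w \<in> topspace X" using kU(1)[of w] that sub(1) Utop by blast
        from u(2)[OF this] show ?thesis using P[of w] that by auto
      qed
      from convex_on_bounded_lipschitz[OF cvx[OF u(1)] r this xy]
      have "\<bar>?F (f x) - ?F (f y)\<bar> \<le> 2 * (P + N) / r * norm (f x - f y)" .
      moreover have "\<bar>\<psi> (f x) - \<psi> (f y)\<bar> \<le> L * norm (f x - f y)"
        using L(2) xy by (simp add: less_imp_le)
      \<comment> \<open>\<open>u\<close> is the convex function minus the potential, so the two
        Lipschitz constants add up.\<close>
      ultimately have "\<bar>u x - u y\<bar> \<le> (2 * (P + N) / r + L) * norm (f x - f y)"
        using k by (auto simp: abs_le_iff algebra_simps)
      also have "\<dots> \<le> c * ((4 * P + 1) + N) * norm (f x - f y)"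
      proof (intro mult_right_mono)
        have "2 * (P + N) / r \<le> 2 / r * ((4 * P + 1) + N)"
          using r P0 by (simp add: divide_right_mono)
        moreover have "L \<le> L / (4 * P + 1) * ((4 * P + 1) + N)"
          using L(1) P0 N0 by (simp add: field_simps)
        ultimately show "2 * (P + N) / r + L \<le> c * ((4 * P + 1) + N)"
          by (simp add: c_def distrib_right)
      qed simp
      finally show ?thesis .
    qed
  qed
qed


section \<open>The uniform bound\<close>

text \<open>The points that \<open>x\<close> is related to form an open set by transitivity. So do
  the others: a related point near \<open>z\<close> would pass the relation on to \<open>z\<close>.
  Local reflexivity puts \<open>x\<close> in the first set, and connectedness makes it
  everything.\<close>

lemma connected_space_transitive_relation:
  assumes X: "connected_space X"
    and trans: "\<And>x y z. R x y \<Longrightarrow> R y z \<Longrightarrow> R x z"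
    and local: "\<And>x. x \<in> topspace X \<Longrightarrow> \<exists>W. openin X W \<and> x \<in> W \<and> (\<forall>y\<in>W. R x y \<and> R y x)"
    and x: "x \<in> topspace X" and y: "y \<in> topspace X"
  shows "R x y"
proof -
  let ?T = "{z \<in> topspace X. R x z}"
  have "\<exists>W. openin X W \<and> z \<in> W \<and> W \<subseteq> ?T" if "z \<in> ?T" for z
  proof -
    have "z \<in> topspace X" "R x z" using that by auto
    then obtain W where "openin X W" "z \<in> W" "\<forall>w\<in>W. R z w \<and> R w z" using local by blast
    then show ?thesis
      using trans[OF \<open>R x z\<close>] openin_subset by (intro exI[of _ W]) blast
  qed
  then have "openin X ?T" by (subst openin_subopen) blast
  moreover have "\<exists>W. openin X W \<and> z \<in> W \<and> W \<subseteq> topspace X - ?T" if "z \<in> topspace X - ?T" for z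
  proof -
    have "z \<in> topspace X" "\<not> R x z" using that by auto
    then obtain W where "openin X W" "z \<in> W" "\<forall>w\<in>W. R z w \<and> R w z" using local by blast
    then show ?thesis
      using trans[of x _ z] \<open>\<not> R x z\<close> openin_subset by (intro exI[of _ W]) blast
  qed
  then have "openin X (topspace X - ?T)" by (subst openin_subopen) blast
  ultimately have "?T = {} \<or> ?T = topspace X"
    using X by (auto simp: connected_space_clopen_in closedin_def)
  moreover have "x \<in> ?T"
    using local[OF x] trans x by blast
  ultimately show ?thesis using y by blast
qed

section \<open>Finite covers and bounds for normalised functions\<close>

lemma compact_space_finite_subcover:
  assumes X: "compact_space X"
    and W: "\<And>p. p \<in> topspace X \<Longrightarrow> openin X (W p) \<and> p \<in> W p"
  obtains F where "finite F" "F \<subseteq> topspace X" "topspace X \<subseteq> (\<Union>p\<in>F. W p)"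
proof -
  have "\<exists>\<F>. finite \<F> \<and> \<F> \<subseteq> W ` topspace X \<and> topspace X \<subseteq> \<Union>\<F>"
    using X[unfolded compact_space_alt, rule_format, of "W ` topspace X"] W by blast
  then show thesis using that by (metis finite_subset_image)
qed

lemma g_convex0_nonpos:
  assumes "u \<in> g_convex0 X A g" "z \<in> topspace X"
  shows "u z \<le> 0"
  using assms cSUP_upper[of z "topspace X" u] by (auto simp: g_convex0_def)

text \<open>Chaining gives a comparison between any two points, with constants depending on the
  points. Compactness leaves only finitely many pairs of centres to consider, and the supremum
  condition provides a point where \<open>- u\<close> is less than 1.\<close>

lemma g_convex0_uniform_bound:
  fixes A :: "('a, 'n::finite) chart set"
  assumes M: "hessian_manifold X A g" and cpt: "compact_space X" and con: "connected_space X"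
  obtains N where "N \<ge> 0"
    "\<And>u x. u \<in> g_convex0 X A g \<Longrightarrow> x \<in> topspace X \<Longrightarrow> \<bar>u x\<bar> \<le> N"
proof (cases "topspace X = {}")
  case True
  then show thesis using that[of 0] by simp
next
  case False
  let ?K = "g_convex0 X A g"
  have "\<exists>W B. openin X W \<and> p \<in> W \<and> B \<ge> (0::real) \<and>
      (\<forall>u\<in>?K. \<forall>x\<in>W. \<forall>y\<in>W. - u y \<le> 2 * (- u x) + B)" if p: "p \<in> topspace X" for p
  proof (rule g_convex_local_estimates[OF M p])
    fix U f W B c l
    assume W: "openin X W" "p \<in> W" "(0::real) \<le> B"
      and half: "\<And>u x y. \<lbrakk>u \<in> g_convex X A g; \<And>z. z \<in> topspace X \<Longrightarrow> u z \<le> 0; x \<in> W; y \<in> W\<rbrakk>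
        \<Longrightarrow> - u y \<le> 2 * (- u x) + B"
    have "- u y \<le> 2 * (- u x) + B" if "u \<in> ?K" "x \<in> W" "y \<in> W" for u x y
      using half[of u x y] g_convex0_nonpos[OF that(1)] that by (auto simp: g_convex0_def)
    with W show ?thesis by blast
  qed
  then obtain W B where W: "\<And>p. p \<in> topspace X \<Longrightarrow> openin X (W p) \<and> p \<in> W p"
    and B: "\<And>p. p \<in> topspace X \<Longrightarrow> B p \<ge> (0::real)"
    and half: "\<And>p u x y. \<lbrakk>p \<in> topspace X; u \<in> ?K; x \<in> W p; y \<in> W p\<rbrakk>
      \<Longrightarrow> - u y \<le> 2 * (- u x) + B p"
    by metis
  \<comment> \<open>The constants are uniform in \<open>u\<close>. Nonnegative slopes allow one
    inequality to be substituted into the next, which gives transitivity.\<close>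
  define R where "R x y \<longleftrightarrow> (\<exists>a\<ge>0. \<exists>b\<ge>0. \<forall>u\<in>?K. - u y \<le> a * (- u x) + (b::real))" for x y
  have Rxy: "R x y" if x: "x \<in> topspace X" and y: "y \<in> topspace X" for x y
  proof (rule connected_space_transitive_relation[OF con _ _ x y, of R])
    show "R x z" if xy: "R x y" and yz: "R y z" for x y z
    proof -
      from xy obtain a b where ab: "a \<ge> 0" "b \<ge> 0" "\<And>u. u \<in> ?K \<Longrightarrow> - u y \<le> a * (- u x) + b"
        unfolding R_def by blast
      from yz obtain c d where cd: "c \<ge> 0" "d \<ge> 0" "\<And>u. u \<in> ?K \<Longrightarrow> - u z \<le> c * (- u y) + d"
        unfolding R_def by blast
      have "- u z \<le> (c * a) * (- u x) + (c * b + d)" if "u \<in> ?K" for u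
        using cd(3)[OF that] mult_left_mono[OF ab(3)[OF that] cd(1)] by (simp add: algebra_simps)
      then show ?thesis
        unfolding R_def using ab cd by (intro exI[of _ "c * a"] conjI exI[of _ "c * b + d"]) auto
    qed
    show "\<exists>V. openin X V \<and> p \<in> V \<and> (\<forall>y\<in>V. R p y \<and> R y p)" if p: "p \<in> topspace X" for p
    proof -
      have "R x y" if "x \<in> W p" "y \<in> W p" for x y
        unfolding R_def using half[OF p _ that] B[OF p]
        by (intro exI[of _ 2] conjI exI[of _ "B p"]) auto
      then show ?thesis using W[OF p] by blast
    qed
  qed
  obtain F where F: "finite F" "F \<subseteq> topspace X" "topspace X \<subseteq> (\<Union>p\<in>F. W p)"
    using compact_space_finite_subcover[OF cpt W] by blast
  have "\<exists>a b. a \<ge> 0 \<and> b \<ge> 0 \<and> (\<forall>u\<in>?K. - u q \<le> a * (- u p) + (b::real))"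
    if "p \<in> F" "q \<in> F" for p q
    using Rxy[of p q] that F(2) unfolding R_def by blast
  then obtain a b where ab: "\<And>p q. \<lbrakk>p \<in> F; q \<in> F\<rbrakk> \<Longrightarrow> a p q \<ge> 0 \<and> b p q \<ge> (0::real)"
    "\<And>p q u. \<lbrakk>p \<in> F; q \<in> F; u \<in> ?K\<rbrakk> \<Longrightarrow> - u q \<le> a p q * (- u p) + b p q"
    by metis
  \<comment> \<open>\<open>h p q\<close> bounds \<open>- u\<close> on \<open>W q\<close> if \<open>- u < 1\<close> somewhere on \<open>W p\<close>.\<close>
  define h where "h p q = 2 * (a p q * (2 + B p) + b p q) + B q" for p q
  \<comment> \<open>The sum stands in for a maximum over pairs: all its terms are nonnegative, so it
    dominates each of them.\<close>
  define N where "N = (\<Sum>p\<in>F. \<Sum>q\<in>F. h p q)"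
  have h0: "h p q \<ge> 0" if "p \<in> F" "q \<in> F" for p q
    using ab(1)[OF that] B[OF subsetD[OF F(2) that(1)]] B[OF subsetD[OF F(2) that(2)]]
    by (simp add: h_def)
  have hN: "h p q \<le> N" if "p \<in> F" "q \<in> F" for p q
  proof -
    have "h p q \<le> (\<Sum>q\<in>F. h p q)"
      using that h0 F(1) by (intro member_le_sum) auto
    also have "\<dots> \<le> N"
      unfolding N_def using that h0 F(1) by (intro member_le_sum) (auto intro: sum_nonneg)
    finally show ?thesis .
  qed
  have "\<bar>u y\<bar> \<le> N" if u: "u \<in> ?K" and y: "y \<in> topspace X" for u y
  proof -
    have "bdd_above (u ` topspace X)" "- 1 < (SUP x\<in>topspace X. u x)"
      using u by (auto simp: g_convex0_def)
    then obtain x where x: "x \<in> topspace X" "- 1 < u x"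
      using less_cSUP_iff[OF False] by blast
    \<comment> \<open>The bound travels from \<open>x\<close> to the centre \<open>p\<close>, from
      there to the centre \<open>q\<close>, and finally to \<open>y\<close>.\<close>
    obtain p q where pq: "p \<in> F" "x \<in> W p" "q \<in> F" "y \<in> W q" using x y F(3) by blast
    have top: "p \<in> topspace X" "q \<in> topspace X" using pq F(2) by auto
    have "- u p \<le> 2 * (- u x) + B p"
      using half[OF top(1) u pq(2)] W[OF top(1)] by blast
    then have "- u p \<le> 2 + B p" using x(2) by simp
    then have "a p q * (- u p) \<le> a p q * (2 + B p)"
      using ab(1)[OF pq(1,3)] by (intro mult_left_mono) auto
    then have "- u q \<le> a p q * (2 + B p) + b p q"
      using ab(2)[OF pq(1,3) u] by simp
    moreover have "- u y \<le> 2 * (- u q) + B q"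
      using half[OF top(2) u _ pq(4)] W[OF top(2)] by blast
    ultimately have "- u y \<le> h p q" by (simp add: h_def)
    then show ?thesis
      using hN[OF pq(1,3)] g_convex0_nonpos[OF u y] by simp
  qed
  moreover have "N \<ge> 0" unfolding N_def using h0 by (intro sum_nonneg) auto
  ultimately show thesis using that by blast
qed


section \<open>Lengths of curves\<close>

lemma pathin_eventually_in:
  assumes \<gamma>: "pathin X \<gamma>" and W: "openin X W" and t: "t \<in> {0..1}" "\<gamma> t \<in> W"
  obtains d where "d > 0" "\<And>s. s \<in> {0..1} \<Longrightarrow> \<bar>s - t\<bar> < d \<Longrightarrow> \<gamma> s \<in> W"
proof -
  have "openin (top_of_set {0..1}) {s \<in> topspace (top_of_set {0..1}). \<gamma> s \<in> W}"
    using \<gamma>[unfolded pathin_def] W by (rule openin_continuous_map_preimage)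
  then obtain d where "d > 0" "\<And>s. s \<in> {0..1} \<Longrightarrow> dist s t < d \<Longrightarrow> \<gamma> s \<in> W"
    using t unfolding openin_euclidean_subtopology_iff by auto
  then show thesis using that by (simp add: dist_real_def)
qed

text \<open>Near \<open>t\<close> the curve stays in \<open>W\<close>, where the new coordinates are
  an affine image of the old ones; the translation part has derivative zero.\<close>

lemma transition_has_vector_derivative:
  fixes f h :: "'a \<Rightarrow> real ^ 'n::finite"
  assumes tr: "affine_transition W f h L b"
    and D: "((f \<circ> \<gamma>) has_vector_derivative D) (at t within T)"
    and t: "t \<in> T" and d: "d > 0" "\<And>s. s \<in> T \<Longrightarrow> \<bar>s - t\<bar> < d \<Longrightarrow> \<gamma> s \<in> W"
  shows "((h \<circ> \<gamma>) has_vector_derivative L *v D) (at t within T)"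
proof (rule has_vector_derivative_transform_within[OF _ d(1) t])
  show "((\<lambda>s. L *v (f \<circ> \<gamma>) s + b) has_vector_derivative L *v D) (at t within T)"
    using bounded_linear.has_vector_derivative[OF matrix_vector_mul_bounded_linear D]
    by (simp add: has_vector_derivative_add_const)
  show "L *v (f \<circ> \<gamma>) s + b = (h \<circ> \<gamma>) s" if "s \<in> T" "dist s t < d" for s
    using tr d(2)[OF that(1)] that(2) by (simp add: affine_transition_def dist_real_def)
qed

lemma piecewise_C1_curveE:
  fixes A :: "('a, 'n::finite) chart set"
  assumes "piecewise_C1_curve X A \<gamma>"
  obtains S where "pathin X \<gamma>" "finite S"
    "\<And>a b U f. \<lbrakk>0 \<le> a; a < b; b \<le> 1; {a<..<b} \<inter> S = {};
        (U, f) \<in> affine_charts X A; \<gamma> ` {a..b} \<subseteq> U\<rbrakk> \<Longrightarrow>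
      \<exists>D. continuous_on {a..b} D \<and>
        (\<forall>t\<in>{a..b}. ((f \<circ> \<gamma>) has_vector_derivative D t) (at t within {a..b}))"
proof -
  from assms obtain S where S: "pathin X \<gamma>" "finite S" and
    C1: "\<forall>a b. 0 \<le> a \<and> a < b \<and> b \<le> 1 \<and> {a<..<b} \<inter> S = {} \<longrightarrow>
      (\<forall>c\<in>affine_charts X A. \<gamma> ` {a..b} \<subseteq> fst c \<longrightarrow>
        (\<exists>D. continuous_on {a..b} D \<and>
          (\<forall>t\<in>{a..b}. ((snd c \<circ> \<gamma>) has_vector_derivative D t) (at t within {a..b}))))"
    unfolding piecewise_C1_curve_def case_prod_unfold by (elim conjE exE) (rule that)
  show thesis
  proof (rule that[OF S])
    fix a b U f
    assume "0 \<le> a" "a < b" "b \<le> 1" "{a<..<b} \<inter> S = {}" and U: "(U, f) \<in> affine_charts X A" "\<gamma> ` {a..b} \<subseteq> U"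
    then show "\<exists>D. continuous_on {a..b} D \<and>
        (\<forall>t\<in>{a..b}. ((f \<circ> \<gamma>) has_vector_derivative D t) (at t within {a..b}))"
      using C1[rule_format, OF _ U(1), of a b] by simp
  qed
qed

text \<open>\<open>speed\<close> uses a chart picked by choice. Covariance of \<open>g\<close>
  cancels the effect of the linear part of the transition on the velocity, so any chart around the
  point gives the same value.\<close>

lemma speed_eq:
  fixes A :: "('a, 'n::finite) chart set"
  assumes M: "hessian_manifold X A g" and cU: "(U, f) \<in> affine_charts X A"
    and \<gamma>: "pathin X \<gamma>" and t: "0 < t" "t < 1" "\<gamma> t \<in> U"
    and D: "((f \<circ> \<gamma>) has_vector_derivative D) (at t)"
  shows "speed X A g \<gamma> t = sqrt (D \<bullet> (g (U, f) (\<gamma> t) *v D))"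
proof -
  have M': "affine_manifold X A" and cov: "covariant X A g"
    using M by (auto simp: hessian_manifold_def riemannian_metric_def)
  define c where "c = (SOME c. c \<in> affine_charts X A \<and> \<gamma> t \<in> fst c)"
  obtain V h where Vh: "c = (V, h)" by (cases c)
  have "c \<in> affine_charts X A \<and> \<gamma> t \<in> fst c"
    unfolding c_def by (rule someI[of _ "(U, f)"]) (use cU t in simp)
  then have cV: "(V, h) \<in> affine_charts X A" "\<gamma> t \<in> V" by (auto simp: Vh)
  obtain W L b where W: "openin X W" "\<gamma> t \<in> W" "W \<subseteq> U \<inter> V" "affine_transition W f h L b"
    by (rule affine_charts_transition[OF M' cU cV(1) t(3) cV(2)])
  have t01: "t \<in> {0..1}" using t by simp
  obtain d where d: "d > 0" "\<And>s. s \<in> {0..1} \<Longrightarrow> \<bar>s - t\<bar> < d \<Longrightarrow> \<gamma> s \<in> W"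
    by (rule pathin_eventually_in[OF \<gamma> W(1) t01 W(2)]) blast
  have "((h \<circ> \<gamma>) has_vector_derivative L *v D) (at t within {0..1})"
    by (rule transition_has_vector_derivative[OF W(4) has_vector_derivative_at_within[OF D] t01 d])
  then have "vector_derivative (h \<circ> \<gamma>) (at t within {0..1}) = L *v D"
    using t by (intro vector_derivative_within_closed_interval) auto
  then have "speed X A g \<gamma> t = sqrt ((L *v D) \<bullet> (g (V, h) (\<gamma> t) *v (L *v D)))"
    unfolding speed_def c_def[symmetric] Vh Let_def by simp
  \<comment> \<open>Moving \<open>L\<close> across the inner product turns the form of
    \<open>(V, h)\<close> into its pullback under \<open>L\<close>, which is the form of
    \<open>(U, f)\<close>.\<close>
  also have "(L *v D) \<bullet> (g (V, h) (\<gamma> t) *v (L *v D)) = D \<bullet> (g (U, f) (\<gamma> t) *v D)"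
    unfolding covariantD[OF cov cU cV(1) W(1,3,4,2)]
    by (simp add: dot_lmul_matrix flip: matrix_vector_mul_assoc)
      (metis dot_lmul_matrix transpose_matrix_vector inner_commute)
  finally show ?thesis .
qed

text \<open>The coordinate displacement is the integral of the velocity \<open>D\<close>, whose norm
  is at most \<open>l\<close> times the speed. Integrability follows because the speed agrees with a
  continuous function off the end points.\<close>

lemma C1_piece_estimate:
  fixes A :: "('a, 'n::finite) chart set"
  assumes M: "hessian_manifold X A g" and cU: "(U, f) \<in> affine_charts X A"
    and \<gamma>: "pathin X \<gamma>" and ab: "0 \<le> a" "a < b" "b \<le> 1" and im: "\<gamma> ` {a..b} \<subseteq> U"
    and D: "continuous_on {a..b} D"
      "\<And>t. t \<in> {a..b} \<Longrightarrow> ((f \<circ> \<gamma>) has_vector_derivative D t) (at t within {a..b})"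
    and l: "\<And>t v. t \<in> {a..b} \<Longrightarrow> norm v \<le> l * sqrt (v \<bullet> (g (U, f) (\<gamma> t) *v v))"
  shows "speed X A g \<gamma> integrable_on {a..b}"
    and "norm (f (\<gamma> a) - f (\<gamma> b)) \<le> l * integral {a..b} (speed X A g \<gamma>)"
proof -
  let ?s = "speed X A g \<gamma>"
  define q where "q t = sqrt (D t \<bullet> (g (U, f) (\<gamma> t) *v D t))" for t
  have "smooth_on (f ` U) (g (U, f) \<circ> inv_into U f)"
    using M cU unfolding hessian_manifold_def riemannian_metric_def by blast
  then have "continuous_on (f ` U) (g (U, f) \<circ> inv_into U f)"
    unfolding smooth_on_def using Ck_on.simps(1) by blast
  moreover have "continuous_on {a..b} (f \<circ> \<gamma>)"
    by (rule continuous_on_vector_derivative[OF D(2)])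
  ultimately have "continuous_on {a..b} ((g (U, f) \<circ> inv_into U f) \<circ> (f \<circ> \<gamma>))"
    using im by (intro continuous_on_compose) (auto simp: image_comp[symmetric] intro: continuous_on_subset)
  moreover have "inv_into U f (f (\<gamma> t)) = \<gamma> t" if "t \<in> {a..b}" for t
    using inv_into_f_f[OF chartD(3)[OF affine_charts_chart[OF cU]], of "\<gamma> t"] im that by blast
  ultimately have "continuous_on {a..b} (\<lambda>t. g (U, f) (\<gamma> t))"
    by (auto elim: continuous_on_eq)
  then have q: "q integrable_on {a..b}"
    unfolding q_def
    by (intro integrable_continuous_real continuous_on_real_sqrt continuous_on_matrix_form D(1))
  \<comment> \<open>At the end points \<open>D\<close> is only a one-sided derivative and
    \<open>speed\<close> may differ from \<open>q\<close>; two points do not affect the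
    integral.\<close>
  have sq: "?s t = q t" if "t \<in> {a..b} - {a, b}" for t
    unfolding q_def
  proof (rule speed_eq[OF M cU \<gamma>])
    show "((f \<circ> \<gamma>) has_vector_derivative D t) (at t)"
      using D(2)[of t] that at_within_Icc_at[of a t b] by auto
  qed (use that ab im in auto)
  show "?s integrable_on {a..b}"
    by (rule integrable_spike_finite[of "{a, b}" _ ?s q]) (use sq q in auto)
  have int_s: "integral {a..b} ?s = integral {a..b} q"
    by (rule integral_spike[of "{a, b}"]) (use sq in auto)
  have "(D has_integral (f \<circ> \<gamma>) b - (f \<circ> \<gamma>) a) {a..b}"
    by (rule fundamental_theorem_of_calculus[OF less_imp_le[OF ab(2)] D(2)])
  then have "norm (f (\<gamma> b) - f (\<gamma> a)) = norm (integral {a..b} D)" "D integrable_on {a..b}"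
    by (auto simp: integral_unique)
  moreover have "norm (integral {a..b} D) \<le> integral {a..b} (\<lambda>t. l * q t)"
    using calculation(2) integrable_on_mult_right[OF q, of l] l
    by (intro Henstock_Kurzweil_Integration.integral_norm_bound_integral) (auto simp: q_def)
  ultimately show "norm (f (\<gamma> a) - f (\<gamma> b)) \<le> l * integral {a..b} ?s"
    by (simp add: int_s norm_minus_commute)
qed

text \<open>In each chart of a finite cover, the product of the Lipschitz constant of
  \<open>u\<close> and the norm comparison constant bounds the change of \<open>u\<close> by the
  length. Additivity over subintervals makes this global.\<close>

lemma g_convex0_curve_length:
  fixes A :: "('a, 'n::finite) chart set"
  assumes M: "hessian_manifold X A g" and cpt: "compact_space X" and con: "connected_space X"
  obtains C where "C > 0"
    "\<And>u \<gamma>. u \<in> g_convex0 X A g \<Longrightarrow> piecewise_C1_curve X A \<gamma>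
      \<Longrightarrow> \<bar>u (\<gamma> 0) - u (\<gamma> 1)\<bar> \<le> C * curve_length X A g \<gamma>"
proof -
  let ?K = "g_convex0 X A g"
  obtain N where N: "N \<ge> 0" "\<And>u x. u \<in> ?K \<Longrightarrow> x \<in> topspace X \<Longrightarrow> \<bar>u x\<bar> \<le> N"
    using g_convex0_uniform_bound[OF M cpt con] by metis
  \<comment> \<open>This bundles the data to be chosen at \<open>p\<close>. The constant
    \<open>m\<close> will absorb the uniform bound \<open>N\<close>, so it no longer depends on
    \<open>u\<close>.\<close>
  define G where "G p U f W m l \<longleftrightarrow> (U, f) \<in> affine_charts X A \<and> openin X W \<and> p \<in> W \<and> W \<subseteq> U \<and>
      m \<ge> (0::real) \<and> l > (0::real) \<and>
      (\<forall>x\<in>W. \<forall>v. norm v \<le> l * sqrt (v \<bullet> (g (U, f) x *v v))) \<and>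
      (\<forall>u\<in>?K. \<forall>x\<in>W. \<forall>y\<in>W. \<bar>u x - u y\<bar> \<le> m * norm (f x - f y))" for p U f W m l
  have "\<exists>U f W m l. G p U f W m l" if p: "p \<in> topspace X" for p
  proof (rule g_convex_local_estimates[OF M p])
    fix U f W B c l
    assume *: "(U, f) \<in> affine_charts X A" "openin X W" "p \<in> W" "W \<subseteq> U" "B \<ge> 0" "c \<ge> 0" "l > 0"
      "\<And>x v. x \<in> W \<Longrightarrow> norm v \<le> l * sqrt (v \<bullet> (g (U, f) x *v v))"
      and lip: "\<And>u N x y. \<lbrakk>u \<in> g_convex X A g; \<And>z. z \<in> topspace X \<Longrightarrow> \<bar>u z\<bar> \<le> N; x \<in> W; y \<in> W\<rbrakk>
        \<Longrightarrow> \<bar>u x - u y\<bar> \<le> c * (B + N) * norm (f x - f y)"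
    have lipK: "\<bar>u x - u y\<bar> \<le> c * (B + N) * norm (f x - f y)"
      if "u \<in> ?K" "x \<in> W" "y \<in> W" for u x y
      using lip[of u N x y] N(2)[OF that(1)] that by (auto simp: g_convex0_def)
    have "c * (B + N) \<ge> 0" using * N(1) by simp
    then have "G p U f W (c * (B + N)) l"
      unfolding G_def by (intro conjI ballI allI) (rule * lipK | assumption)+
    then show ?thesis by blast
  qed
  then obtain U f W m l where "\<And>p. p \<in> topspace X \<Longrightarrow> G p (U p) (f p) (W p) (m p) (l p)"
    by metis
  then have
    cU: "\<And>p. p \<in> topspace X \<Longrightarrow> (U p, f p) \<in> affine_charts X A" and
    W: "\<And>p. p \<in> topspace X \<Longrightarrow> openin X (W p) \<and> p \<in> W p" and
    WU: "\<And>p. p \<in> topspace X \<Longrightarrow> W p \<subseteq> U p" and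
    ml: "\<And>p. p \<in> topspace X \<Longrightarrow> m p \<ge> (0::real) \<and> l p > (0::real)" and
    l: "\<And>p x v. p \<in> topspace X \<Longrightarrow> x \<in> W p
      \<Longrightarrow> norm v \<le> l p * sqrt (v \<bullet> (g (U p, f p) x *v v))" and
    m: "\<And>p u x y. \<lbrakk>p \<in> topspace X; u \<in> ?K; x \<in> W p; y \<in> W p\<rbrakk>
      \<Longrightarrow> \<bar>u x - u y\<bar> \<le> m p * norm (f p x - f p y)"
    unfolding G_def by blast+
  obtain F where F: "finite F" "F \<subseteq> topspace X" "topspace X \<subseteq> (\<Union>p\<in>F. W p)"
    using compact_space_finite_subcover[OF cpt W] by blast
  \<comment> \<open>The sum dominates every product \<open>m p * l p\<close>; the extra 1 makes
    \<open>C\<close> positive in all cases.\<close>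
  define C where "C = 1 + (\<Sum>p\<in>F. m p * l p)"
  have ml0: "m p * l p \<ge> 0" if "p \<in> F" for p using ml[of p] that F(2) by auto
  have mlC: "m p * l p \<le> C" if "p \<in> F" for p
    using member_le_sum[of p F "\<lambda>p. m p * l p"] that ml0 F(1) by (auto simp: C_def)
  have C: "C > 0" unfolding C_def using sum_nonneg[of F "\<lambda>p. m p * l p"] ml0 by fastforce
  have "\<bar>u (\<gamma> 0) - u (\<gamma> 1)\<bar> \<le> C * curve_length X A g \<gamma>"
    if u: "u \<in> ?K" and pw: "piecewise_C1_curve X A \<gamma>" for u \<gamma>
  proof -
    let ?s = "speed X A g \<gamma>"
    have \<gamma>: "pathin X \<gamma>" using pw by (simp add: piecewise_C1_curve_def)
    obtain S where S: "finite S"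
      and C1: "\<And>a b V h. \<lbrakk>0 \<le> a; a < b; b \<le> 1; {a<..<b} \<inter> S = {};
          (V, h) \<in> affine_charts X A; \<gamma> ` {a..b} \<subseteq> V\<rbrakk> \<Longrightarrow>
        \<exists>D. continuous_on {a..b} D \<and>
          (\<forall>t\<in>{a..b}. ((h \<circ> \<gamma>) has_vector_derivative D t) (at t within {a..b}))"
      by (rule piecewise_C1_curveE[OF pw]) blast
    \<comment> \<open>Integrability is carried along because additivity of the integral requires it.
      The guard makes \<open>P\<close> vacuous for intervals leaving the unit interval, which occur
      in the local condition of \<open>Bolzano\<close>.\<close>
    define P where "P a b \<longleftrightarrow> (0 \<le> a \<and> a \<le> b \<and> b \<le> 1 \<longrightarrow>
      ?s integrable_on {a..b} \<and> \<bar>u (\<gamma> a) - u (\<gamma> b)\<bar> \<le> C * integral {a..b} ?s)" for a b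
    have P_trans: "P a c" if "P a b" "P b c" "a \<le> b" "b \<le> c" for a b c
    proof (cases "0 \<le> a \<and> c \<le> 1")
      case True
      then have *: "?s integrable_on {a..b}" "?s integrable_on {b..c}"
        "\<bar>u (\<gamma> a) - u (\<gamma> b)\<bar> \<le> C * integral {a..b} ?s"
        "\<bar>u (\<gamma> b) - u (\<gamma> c)\<bar> \<le> C * integral {b..c} ?s"
        using that by (auto simp: P_def)
      have i: "?s integrable_on {a..c}"
        using Henstock_Kurzweil_Integration.integrable_combine[OF that(3,4) *(1,2)] .
      have "C * integral {a..c} ?s = C * integral {a..b} ?s + C * integral {b..c} ?s"
        using Henstock_Kurzweil_Integration.integral_combine[OF that(3,4) i]
        by (simp flip: distrib_left)
      then show ?thesis using i *(3,4) by (auto simp: P_def abs_le_iff)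
    qed (use that in \<open>auto simp: P_def\<close>)
    have "P 0 1"
    proof (rule Bolzano)
      show "P a c" if "P a b" "P b c" "a \<le> b" "b \<le> c" for a b c using that by (rule P_trans)
      fix t :: real assume t: "0 \<le> t" "t \<le> 1"
      then have t01: "t \<in> {0..1}" by simp
      then have "\<gamma> t \<in> topspace X" using path_image_subset_topspace[OF \<gamma>] by blast
      then obtain p where p: "p \<in> F" "\<gamma> t \<in> W p" using F(3) by blast
      then have ptop: "p \<in> topspace X" using F(2) by blast
      obtain d where d: "d > 0" "\<And>s. s \<in> {0..1} \<Longrightarrow> \<bar>s - t\<bar> < d \<Longrightarrow> \<gamma> s \<in> W p"
        using pathin_eventually_in[OF \<gamma> _ t01 p(2)] W[OF ptop] by blast
      \<comment> \<open>Within distance \<open>e\<close> of \<open>t\<close> the only possible break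
        point is \<open>t\<close> itself.\<close>
      obtain e where e: "e > 0" "\<And>s. s \<in> S \<Longrightarrow> s \<noteq> t \<Longrightarrow> e \<le> dist t s"
        using finite_set_avoid[OF S] by blast
      \<comment> \<open>Since \<open>t\<close> may be a break point, intervals ending at
        \<open>t\<close> are treated first; a general interval around \<open>t\<close> is then split
        there.\<close>
      have piece: "P a b" if ab: "a \<le> t" "t \<le> b" "a = t \<or> b = t" "b - a < min d e" for a b
      proof (cases "0 \<le> a \<and> a < b \<and> b \<le> 1")
        case True
        have imW: "\<gamma> x \<in> W p" if "x \<in> {a..b}" for x
          using that True ab by (intro d(2)) auto
        then have im: "\<gamma> ` {a..b} \<subseteq> U p" using WU[OF ptop] by blast
        have "{a<..<b} \<inter> S = {}"
        proof (rule ccontr)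
          assume "{a<..<b} \<inter> S \<noteq> {}"
          then obtain s where "s \<in> S" "a < s" "s < b" by auto
          then show False using e(2)[of s] ab by (auto simp: dist_real_def)
        qed
        then obtain D where D: "continuous_on {a..b} D"
          "\<And>x. x \<in> {a..b} \<Longrightarrow> ((f p \<circ> \<gamma>) has_vector_derivative D x) (at x within {a..b})"
          using C1[of a b, OF _ _ _ _ cU[OF ptop] im] True by blast
        note est = C1_piece_estimate[OF M cU[OF ptop] \<gamma> _ _ _ im D l[OF ptop imW]]
        have i: "?s integrable_on {a..b}" and
          le: "norm (f p (\<gamma> a) - f p (\<gamma> b)) \<le> l p * integral {a..b} ?s"
          using est True by blast+
        have "0 \<le> l p * integral {a..b} ?s" using le norm_ge_zero order_trans by blast
        then have int0: "0 \<le> integral {a..b} ?s"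
          using ml[OF ptop] by (simp add: zero_le_mult_iff)
        have "\<bar>u (\<gamma> a) - u (\<gamma> b)\<bar> \<le> m p * norm (f p (\<gamma> a) - f p (\<gamma> b))"
          using True by (intro m[OF ptop u] imW) auto
        also have "\<dots> \<le> m p * (l p * integral {a..b} ?s)"
          using ml[OF ptop] le by (intro mult_left_mono) auto
        also have "\<dots> \<le> C * integral {a..b} ?s"
          using mult_right_mono[OF mlC[OF p(1)] int0] by (simp add: mult.assoc)
        finally show ?thesis using i by (simp add: P_def)
      next
        case False
        then show ?thesis using ab integrable_on_refl[of ?s t] by (auto simp: P_def)
      qed
      have "P a b" if "a \<le> t" "t \<le> b" "b - a < min d e" for a b
        by (rule P_trans[of a t b]) (use that in \<open>auto intro!: piece\<close>)
      then show "\<exists>\<delta>>0. \<forall>a b. a \<le> t \<and> t \<le> b \<and> b - a < \<delta> \<longrightarrow> P a b"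
        using d(1) e(1) by (intro exI[of _ "min d e"]) auto
    qed simp
    then show ?thesis by (simp add: P_def curve_length_def)
  qed
  with C show thesis by (rule that)
qed


section \<open>Connecting points by piecewise \<open>C\<^sup>1\<close> curves\<close>

lemma piecewise_C1_curveI:
  fixes A :: "('a, 'n::finite) chart set"
  assumes "pathin X \<gamma>" "finite S"
    "\<And>a b U f. \<lbrakk>0 \<le> a; a < b; b \<le> 1; {a<..<b} \<inter> S = {};
        (U, f) \<in> affine_charts X A; \<gamma> ` {a..b} \<subseteq> U\<rbrakk> \<Longrightarrow>
      \<exists>D. continuous_on {a..b} D \<and>
        (\<forall>t\<in>{a..b}. ((f \<circ> \<gamma>) has_vector_derivative D t) (at t within {a..b}))"
  shows "piecewise_C1_curve X A \<gamma>"
  unfolding piecewise_C1_curve_def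
  using assms by (intro conjI exI[of _ S]) (clarify | assumption)+

text \<open>This fits a coordinate segment seen in another affine chart, where the transition has
  one linear part near each point. Derivatives on a nondegenerate closed interval are unique, so the
  selected derivative is locally constant and hence continuous.\<close>

lemma C1_of_locally_constant_derivative:
  fixes c :: "real \<Rightarrow> 'b::euclidean_space"
  assumes ab: "a < b"
    and loc: "\<And>t. t \<in> {a..b} \<Longrightarrow> \<exists>d>0. \<exists>w. \<forall>s\<in>{a..b}. \<bar>s - t\<bar> < d \<longrightarrow>
      (c has_vector_derivative w) (at s within {a..b})"
  shows "\<exists>D. continuous_on {a..b} D \<and>
    (\<forall>t\<in>{a..b}. (c has_vector_derivative D t) (at t within {a..b}))"
proof -
  define D where "D s = vector_derivative c (at s within {a..b})" for s
  have Deq: "D s = w" if "s \<in> {a..b}" "(c has_vector_derivative w) (at s within {a..b})" for s w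
    unfolding D_def using that ab by (intro vector_derivative_within_closed_interval) auto
  have "(c has_vector_derivative D t) (at t within {a..b})" if t: "t \<in> {a..b}" for t
  proof -
    obtain d w where "d > 0" "\<forall>s\<in>{a..b}. \<bar>s - t\<bar> < d \<longrightarrow>
      (c has_vector_derivative w) (at s within {a..b})"
      using loc[OF t] by blast
    then have "(c has_vector_derivative w) (at t within {a..b})" using t by simp
    then show ?thesis using Deq[OF t] by simp
  qed
  moreover have "continuous (at t within {a..b}) D" if t: "t \<in> {a..b}" for t
  proof -
    obtain d w where d: "d > 0" "\<forall>s\<in>{a..b}. \<bar>s - t\<bar> < d \<longrightarrow>
      (c has_vector_derivative w) (at s within {a..b})"
      using loc[OF t] by blast
    have "continuous (at t within {a..b}) (\<lambda>_. w)" by simp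
    then show ?thesis
      by (rule continuous_transform_within[OF _ d(1) t])
        (use d(2) Deq in \<open>auto simp: dist_real_def\<close>)
  qed
  ultimately show ?thesis
    by (intro exI[of _ D]) (auto simp: continuous_on_eq_continuous_within)
qed

text \<open>The coordinate segment is lifted by the inverse chart. In every other affine chart its
  velocity is locally constant, so it has no break points.\<close>

lemma segment_piecewise_C1:
  fixes A :: "('a, 'n::finite) chart set"
  assumes M: "affine_manifold X A" and cU: "(U, f) \<in> affine_charts X A"
    and cvx: "convex (f ` U)" and xy: "x \<in> U" "y \<in> U"
  shows "\<exists>\<gamma>. piecewise_C1_curve X A \<gamma> \<and> \<gamma> 0 = x \<and> \<gamma> 1 = y"
proof -
  have ch: "chart X (U, f)" using cU by (rule affine_charts_chart)
  have inj: "inj_on f U" using chartD(3)[OF ch] .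
  let ?k = "inv_into U f"
  define \<sigma> where "\<sigma> t = f x + t *\<^sub>R (f y - f x)" for t
  define \<gamma> where "\<gamma> = ?k \<circ> \<sigma>"
  have \<sigma>: "\<sigma> t \<in> f ` U" if "t \<in> {0..1}" for t
  proof -
    have "(1 - t) *\<^sub>R f x + t *\<^sub>R f y \<in> f ` U"
      using cvx xy that unfolding convex_alt by (meson atLeastAtMost_iff imageI)
    then show ?thesis by (simp add: \<sigma>_def algebra_simps)
  qed
  have "continuous_on {0..1} \<sigma>" unfolding \<sigma>_def by (intro continuous_intros)
  then have "continuous_map (top_of_set {0..1}) (top_of_set (f ` U)) \<sigma>"
    using \<sigma> by (auto simp: continuous_map_in_subtopology)
  then have path: "pathin X \<gamma>"
    unfolding pathin_def \<gamma>_def using chartD(5)[OF ch] by (rule continuous_map_compose)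
  have f\<gamma>: "f (\<gamma> t) = \<sigma> t" "\<gamma> t \<in> U" if "t \<in> {0..1}" for t
    using f_inv_into_f[OF \<sigma>[OF that]] inv_into_into[OF \<sigma>[OF that]] by (auto simp: \<gamma>_def)
  have "piecewise_C1_curve X A \<gamma>"
  proof (rule piecewise_C1_curveI[OF path, of "{}"])
    fix a b V h assume ab: "(0::real) \<le> a" "a < b" "b \<le> 1"
      and cV: "(V, h) \<in> affine_charts X A" and im: "\<gamma> ` {a..b} \<subseteq> V"
    have sub: "{a..b} \<subseteq> {0..1}" using ab by auto
    show "\<exists>D. continuous_on {a..b} D \<and>
      (\<forall>t\<in>{a..b}. ((h \<circ> \<gamma>) has_vector_derivative D t) (at t within {a..b}))"
    proof (rule C1_of_locally_constant_derivative[OF ab(2)])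
      fix t assume t: "t \<in> {a..b}"
      then have t01: "t \<in> {0..1}" and tV: "\<gamma> t \<in> V" using sub im by auto
      obtain W L c where W: "openin X W" "\<gamma> t \<in> W" "W \<subseteq> U \<inter> V" "affine_transition W f h L c"
        by (rule affine_charts_transition[OF M cU cV f\<gamma>(2)[OF t01] tV])
      obtain d where d: "d > 0" "\<And>s. s \<in> {0..1} \<Longrightarrow> \<bar>s - t\<bar> < d \<Longrightarrow> \<gamma> s \<in> W"
        by (rule pathin_eventually_in[OF path W(1) t01 W(2)]) blast
      have "((h \<circ> \<gamma>) has_vector_derivative L *v (f y - f x)) (at s within {a..b})"
        if s: "s \<in> {a..b}" "\<bar>s - t\<bar> < d" for s
      proof (rule transition_has_vector_derivative[OF W(4) _ s(1)])
        have "(\<sigma> has_vector_derivative (f y - f x)) (at s within {a..b})"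
          unfolding \<sigma>_def by (auto intro!: derivative_eq_intros)
        then show "((f \<circ> \<gamma>) has_vector_derivative (f y - f x)) (at s within {a..b})"
          by (rule has_vector_derivative_transform[OF s(1), rotated]) (use f\<gamma> sub in auto)
        \<comment> \<open>This is the room left around \<open>s\<close> inside the interval around
          \<open>t\<close> on which the curve stays in \<open>W\<close>.\<close>
        show "d - \<bar>s - t\<bar> > 0" using s by simp
        show "\<gamma> r \<in> W" if "r \<in> {a..b}" "\<bar>r - s\<bar> < d - \<bar>s - t\<bar>" for r
          using that sub by (intro d(2)) auto
      qed
      then show "\<exists>d>0. \<exists>w. \<forall>s\<in>{a..b}. \<bar>s - t\<bar> < d \<longrightarrow>
          ((h \<circ> \<gamma>) has_vector_derivative w) (at s within {a..b})"
        using d(1) by blast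
    qed
  qed simp
  moreover have "\<gamma> 0 = x" "\<gamma> 1 = y" using inj xy by (auto simp: \<gamma>_def \<sigma>_def)
  ultimately show ?thesis by blast
qed

section \<open>Concatenation of curves\<close>

lemma C1_reparametrize:
  fixes c e :: "real \<Rightarrow> 'b::real_normed_vector"
  assumes C1: "\<exists>D. continuous_on {2 * a + m..2 * b + m} D \<and>
      (\<forall>t\<in>{2 * a + m..2 * b + m}. (c has_vector_derivative D t) (at t within {2 * a + m..2 * b + m}))"
    and e: "\<And>s. s \<in> {a..b} \<Longrightarrow> e s = c (2 * s + m)"
  shows "\<exists>D. continuous_on {a..b} D \<and>
    (\<forall>t\<in>{a..b}. (e has_vector_derivative D t) (at t within {a..b}))"
proof -
  obtain D where D: "continuous_on {2 * a + m..2 * b + m} D"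
    "\<And>t. t \<in> {2 * a + m..2 * b + m} \<Longrightarrow> (c has_vector_derivative D t) (at t within {2 * a + m..2 * b + m})"
    using C1 by blast
  let ?r = "\<lambda>s::real. 2 * s + m"
  have im: "?r ` {a..b} \<subseteq> {2 * a + m..2 * b + m}" by auto
  have "continuous_on {a..b} (\<lambda>s. 2 *\<^sub>R D (?r s))"
    by (intro continuous_intros continuous_on_compose2[OF D(1) _ im])
  moreover have "(e has_vector_derivative 2 *\<^sub>R D (?r t)) (at t within {a..b})" if t: "t \<in> {a..b}" for t
  proof -
    have "(?r has_vector_derivative 2) (at t within {a..b})"
      by (auto intro!: derivative_eq_intros)
    moreover have "(c has_vector_derivative D (?r t)) (at (?r t) within ?r ` {a..b})"
      by (rule has_vector_derivative_within_subset[OF D(2) im]) (use t in auto)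
    ultimately have "((c \<circ> ?r) has_vector_derivative 2 *\<^sub>R D (?r t)) (at t within {a..b})"
      by (rule vector_diff_chain_within)
    then show ?thesis
      by (rule has_vector_derivative_transform[OF t, rotated]) (use e in auto)
  qed
  ultimately show ?thesis by blast
qed

lemma piecewise_C1_curve_join:
  fixes A :: "('a, 'n::finite) chart set"
  assumes pw: "piecewise_C1_curve X A \<gamma>" "piecewise_C1_curve X A \<delta>" and eq: "\<gamma> 1 = \<delta> 0"
  shows "\<exists>\<eta>. piecewise_C1_curve X A \<eta> \<and> \<eta> 0 = \<gamma> 0 \<and> \<eta> 1 = \<delta> 1"
proof -
  obtain S where \<gamma>: "pathin X \<gamma>" "finite S"
    "\<And>a b U f. \<lbrakk>0 \<le> a; a < b; b \<le> 1; {a<..<b} \<inter> S = {};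
        (U, f) \<in> affine_charts X A; \<gamma> ` {a..b} \<subseteq> U\<rbrakk> \<Longrightarrow>
      \<exists>D. continuous_on {a..b} D \<and>
        (\<forall>t\<in>{a..b}. ((f \<circ> \<gamma>) has_vector_derivative D t) (at t within {a..b}))"
    by (rule piecewise_C1_curveE[OF pw(1)]) blast
  obtain T where \<delta>: "pathin X \<delta>" "finite T"
    "\<And>a b U f. \<lbrakk>0 \<le> a; a < b; b \<le> 1; {a<..<b} \<inter> T = {};
        (U, f) \<in> affine_charts X A; \<delta> ` {a..b} \<subseteq> U\<rbrakk> \<Longrightarrow>
      \<exists>D. continuous_on {a..b} D \<and>
        (\<forall>t\<in>{a..b}. ((f \<circ> \<delta>) has_vector_derivative D t) (at t within {a..b}))"
    by (rule piecewise_C1_curveE[OF pw(2)]) blast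
  let ?I = "top_of_set {0..1::real}"
  \<comment> \<open>The summands \<open>+ 0\<close> and \<open>+ (- 1)\<close> keep both halves in
    the form \<open>2 * s + m\<close> expected by \<open>C1_reparametrize\<close>.\<close>
  define \<eta> where "\<eta> t = (if t \<le> 1/2 then (\<gamma> \<circ> (\<lambda>t. 2 * t + 0)) t else (\<delta> \<circ> (\<lambda>t. 2 * t + (- 1))) t)"
    for t :: real
  have left: "\<eta> t = \<gamma> (2 * t + 0)" if "t \<le> 1/2" for t using that by (simp add: \<eta>_def)
  have right: "\<eta> t = \<delta> (2 * t + (- 1))" if "t \<ge> 1/2" for t
  proof (cases "t = 1/2")
    case True
    then show ?thesis using eq unfolding \<eta>_def True by simp
  qed (use that in \<open>simp add: \<eta>_def\<close>)
  have path: "pathin X \<eta>"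
    unfolding pathin_def \<eta>_def
  proof (intro continuous_map_cases_le continuous_map_compose, force, force)
    show "continuous_map (subtopology ?I {x \<in> topspace ?I. x \<le> 1/2}) ?I (\<lambda>t. 2 * t + 0)"
      by (auto simp: subtopology_subtopology continuous_map_in_subtopology intro!: continuous_intros)
    show "continuous_map (subtopology ?I {x \<in> topspace ?I. 1/2 \<le> x}) ?I (\<lambda>t. 2 * t + (- 1))"
      by (auto simp: subtopology_subtopology continuous_map_in_subtopology intro!: continuous_intros)
    show "continuous_map ?I X \<gamma>" "continuous_map ?I X \<delta>"
      using \<gamma>(1) \<delta>(1) by (simp_all add: pathin_def)
    show "(\<gamma> \<circ> (\<lambda>t. 2 * t + 0)) x = (\<delta> \<circ> (\<lambda>t. 2 * t + (- 1))) x" if "x = 1/2" for x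
      using eq unfolding that by simp
  qed
  \<comment> \<open>The joint may be a corner. The other break points are those of the two curves,
    moved by the inverse reparametrizations.\<close>
  let ?S = "insert (1/2) ((\<lambda>t. t / 2) ` S \<union> (\<lambda>t. (t + 1) / 2) ` T)"
  have "piecewise_C1_curve X A \<eta>"
  proof (rule piecewise_C1_curveI[OF path, of ?S])
    fix a b U f assume ab: "0 \<le> a" "a < b" "b \<le> 1" "{a<..<b} \<inter> ?S = {}"
      and U: "(U, f) \<in> affine_charts X A" and im: "\<eta> ` {a..b} \<subseteq> U"
    \<comment> \<open>An interval without a break point in its interior therefore lies in one half
      and involves only one of the curves.\<close>
    have "1/2 \<notin> {a<..<b}" using ab(4) by blast
    then consider "b \<le> 1/2" | "1/2 \<le> a" using ab(2) by fastforce
    then show "\<exists>D. continuous_on {a..b} D \<and>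
        (\<forall>t\<in>{a..b}. ((f \<circ> \<eta>) has_vector_derivative D t) (at t within {a..b}))"
    proof cases
      case 1
      have disj: "{2 * a + 0<..<2 * b + 0} \<inter> S = {}"
      proof (rule ccontr)
        assume "{2 * a + 0<..<2 * b + 0} \<inter> S \<noteq> {}"
        then obtain s where "s \<in> S" "2 * a < s" "s < 2 * b" by auto
        then have "s / 2 \<in> {a<..<b} \<inter> ?S" by auto
        then show False using ab(4) by blast
      qed
      have "\<gamma> t \<in> U" if "t \<in> {2 * a + 0..2 * b + 0}" for t
      proof -
        have "\<eta> (t / 2) = \<gamma> t" "t / 2 \<in> {a..b}" using left[of "t / 2"] that 1 by auto
        then show ?thesis using im by (metis imageI subsetD)
      qed
      then have im': "\<gamma> ` {2 * a + 0..2 * b + 0} \<subseteq> U" by blast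
      have "\<exists>D. continuous_on {2 * a + 0..2 * b + 0} D \<and> (\<forall>t\<in>{2 * a + 0..2 * b + 0}.
          ((f \<circ> \<gamma>) has_vector_derivative D t) (at t within {2 * a + 0..2 * b + 0}))"
        by (rule \<gamma>(3)[OF _ _ _ disj U im']) (use ab 1 in auto)
      then show ?thesis
        by (rule C1_reparametrize) (use left 1 in simp)
    next
      case 2
      have disj: "{2 * a + (- 1)<..<2 * b + (- 1)} \<inter> T = {}"
      proof (rule ccontr)
        assume "{2 * a + (- 1)<..<2 * b + (- 1)} \<inter> T \<noteq> {}"
        then obtain s where "s \<in> T" "2 * a - 1 < s" "s < 2 * b - 1" by auto
        then have "(s + 1) / 2 \<in> {a<..<b} \<inter> ?S" by auto
        then show False using ab(4) by blast
      qed
      have "\<delta> t \<in> U" if "t \<in> {2 * a + (- 1)..2 * b + (- 1)}" for t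
      proof -
        have eq: "2 * ((t + 1) / 2) + (- 1) = t" by (simp add: field_simps)
        have "1/2 \<le> (t + 1) / 2" "(t + 1) / 2 \<in> {a..b}" using that 2 by auto
        moreover from this(1) have "\<eta> ((t + 1) / 2) = \<delta> t"
          using right[of "(t + 1) / 2"] unfolding eq by blast
        ultimately show ?thesis using im by (metis imageI subsetD)
      qed
      then have im': "\<delta> ` {2 * a + (- 1)..2 * b + (- 1)} \<subseteq> U" by blast
      have "\<exists>D. continuous_on {2 * a + (- 1)..2 * b + (- 1)} D \<and> (\<forall>t\<in>{2 * a + (- 1)..2 * b + (- 1)}.
          ((f \<circ> \<delta>) has_vector_derivative D t) (at t within {2 * a + (- 1)..2 * b + (- 1)}))"
        by (rule \<delta>(3)[OF _ _ _ disj U im']) (use ab 2 in auto)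
      then show ?thesis
        by (rule C1_reparametrize) (use right 2 in simp)
    qed
  qed (use \<gamma>(2) \<delta>(2) in simp)
  moreover have "\<eta> 0 = \<gamma> 0" "\<eta> 1 = \<delta> 1" using left[of 0] right[of 1] by simp_all
  ultimately show ?thesis by blast
qed

text \<open>Joinability is transitive by concatenation, and the segments of a ball chart join its
  points in both directions.\<close>

lemma piecewise_C1_connected:
  fixes A :: "('a, 'n::finite) chart set"
  assumes M: "hessian_manifold X A g" and con: "connected_space X"
    and xy: "x \<in> topspace X" "y \<in> topspace X"
  shows "\<exists>\<gamma>. piecewise_C1_curve X A \<gamma> \<and> \<gamma> 0 = x \<and> \<gamma> 1 = y"
proof (rule connected_space_transitive_relation[OF con _ _ xy])
  let ?R = "\<lambda>x y. \<exists>\<gamma>. piecewise_C1_curve X A \<gamma> \<and> \<gamma> 0 = x \<and> \<gamma> 1 = y"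
  show "?R x z" if "?R x y" "?R y z" for x y z
    using that piecewise_C1_curve_join by metis
  show "\<exists>W. openin X W \<and> p \<in> W \<and> (\<forall>q\<in>W. ?R p q \<and> ?R q p)" if p: "p \<in> topspace X" for p
  proof -
    obtain U f \<phi> R where U: "(U, f) \<in> affine_charts X A" "p \<in> U" and im: "f ` U = ball (f p) R"
      by (rule hessian_manifold_ball_chart[OF M p])
    have "affine_manifold X A" using M by (simp add: hessian_manifold_def)
    then have "?R p q \<and> ?R q p" if "q \<in> U" for q
      using segment_piecewise_C1[OF _ U(1)] U(2) that by (simp add: im)
    then show ?thesis
      using U chartD(1)[OF affine_charts_chart[OF U(1)]] by blast
  qed
qed

section \<open>From curve lengths to the Riemannian distance\<close>

theorem lemma1p9:
  fixes X :: "'a topology"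
    and A :: "('a, 'n::finite) chart set"
    and g :: "('a, 'n) tensor2"
  assumes "hessian_manifold X A g"
    and "compact_space X"
    and "connected_space X"
  shows "\<exists>C\<^sub>1>0. \<forall>u\<in>g_convex0 X A g. \<forall>x\<in>topspace X. \<forall>x'\<in>topspace X.
           \<bar>u x - u x'\<bar> \<le> C\<^sub>1 * riem_dist X A g x x'"
proof -
  obtain C where C: "C > 0" and len: "\<And>u \<gamma>. \<lbrakk>u \<in> g_convex0 X A g; piecewise_C1_curve X A \<gamma>\<rbrakk>
      \<Longrightarrow> \<bar>u (\<gamma> 0) - u (\<gamma> 1)\<bar> \<le> C * curve_length X A g \<gamma>"
    by (rule g_convex0_curve_length[OF assms]) (rule that)
  have "\<bar>u x - u x'\<bar> \<le> C * riem_dist X A g x x'"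
    if u: "u \<in> g_convex0 X A g" and x: "x \<in> topspace X" "x' \<in> topspace X" for u x x'
  proof -
    \<comment> \<open>After division by \<open>C\<close> the left side is a lower bound for the
      lengths of all joining curves. As such curves exist, it is also at most their infimum.\<close>
    have "\<bar>u x - u x'\<bar> / C \<le> riem_dist X A g x x'"
      unfolding riem_dist_def
    proof (rule cInf_greatest)
      show "{curve_length X A g \<gamma> |\<gamma>. piecewise_C1_curve X A \<gamma> \<and> \<gamma> 0 = x \<and> \<gamma> 1 = x'} \<noteq> {}"
        using piecewise_C1_connected[OF assms(1,3) x] by blast
      show "\<bar>u x - u x'\<bar> / C \<le> l"
        if "l \<in> {curve_length X A g \<gamma> |\<gamma>. piecewise_C1_curve X A \<gamma> \<and> \<gamma> 0 = x \<and> \<gamma> 1 = x'}" for l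
        using that len[OF u] C by (auto simp: field_simps)
    qed
    then show ?thesis using C by (simp add: field_simps)
  qed
  with C show ?thesis by blast
qed

end
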